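(* Let $\rho\in\mathbb{C}$, $x\in\mathbb{R}$, and let $a,b,c\in\mathbb{C}$ be such that $\Re a>0$, $\Re b>0$, $\Re c>0$ and $\Im a=\Im b=\Im c$. Then $$ {}_1F_1\!\left(\begin{matrix}a+ix\\ 2\Re a\end{matrix};-i\rho\right){}_1F_1\!\left(\begin{matrix}\overline{b}-ix\\ 2\Re b\end{matrix};i\rho\right) =\sum_{k=0}^\infty \frac{(k+2\Re a+2\Re b-1)_k}{(2\Re a)_k\,(2\Re b)_k\,(k+2\Re a+2\Re c-1)_k}\,\rho^k\,p_k(x;a,c,\overline{a},\overline{c}) $$ $$ \times\ {}_4F_5\!\left(\begin{matrix}\tfrac12(\Re a+\Re b+k),\ \tfrac12(\Re a+\Re b+k+1),\ \Re a+\Re b+k-\tfrac12,\ \Re b-\Re c\\ \Re a+\Re b+\tfrac{k-1}{2},\ \Re a+\Re b+\tfrac{k}{2},\ \Re b+\tfrac{k}{2},\ \Re b+\tfrac{k+1}{2},\ \Re a+\Re c+k+\tfrac12\end{matrix};\frac{-\rho^2}{4}\right). $$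
   Context: The Pochhammer symbol is $(z)_n=\prod_{i=1}^n(z+i-1)$ for $z\in\mathbb{C}$, $n\in\{0,1,2,\dots\}$ (so $(z)_0=1$). For $a_1,\dots,a_p\in\mathbb{C}$ and $b_1,\dots,b_q\in\mathbb{C}\setminus\{0,-1,-2,\dots\}$ the generalized hypergeometric function is ${}_pF_q(a_1,\dots,a_p;b_1,\dots,b_q;z)=\sum_{n\ge0}\frac{(a_1)_n\cdots(a_p)_n}{(b_1)_n\cdots(b_q)_n}\frac{z^n}{n!}$; for $p\le q$ it is defined for all $z\in\mathbb{C}$. The continuous Hahn polynomials with two pairs of conjugate parameters are, for $a,b\in\mathbb{C}$ with positive real parts, $$p_n(x;a,b,\overline{a},\overline{b})=i^n\frac{(2\Re a)_n(a+\overline{b})_n}{n!}\ {}_3F_2\!\left(\begin{matrix}-n,\ n+2\Re a+2\Re b-1,\ a+ix\\ 2\Re a,\ a+\overline{b}\end{matrix};1\right).$$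
   Formalization: When Re a + Re b = 1/2, the k = 0 term's 4F5 has lower parameter 0 and is undefined as printed; there it is read with the equal upper and lower parameters Re a + Re b + k − 1/2 and Re a + Re b + (k−1)/2 cancelled. All other cases are literal. *)

theory Defs
  imports "HOL-Analysis.Analysis"
begin

text \<open>
  The generalized hypergeometric function, as the value of the library's hypergeometric formal
  power series.  It has its usual meaning if no lower parameter is in \<open>{0, -1, -2, \<dots>}\<close> and the
  series converges (\<open>length as \<le> length bs\<close>, or some upper parameter in \<open>{0, -1, -2, \<dots>}\<close>).
\<close>

definition hypergeometric :: "complex list \<Rightarrow> complex list \<Rightarrow> complex \<Rightarrow> complex" where
  "hypergeometric as bs z = eval_fps (fps_hypergeo as bs 1) z"

lemma hypergeometric_altdef:
  "hypergeometric as bs z =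
     (\<Sum>n. prod_list (map (\<lambda>a. pochhammer a n) as) / prod_list (map (\<lambda>b. pochhammer b n) bs)
            * (z ^ n / fact n))"
proof -
  have *: "foldl (\<lambda>r a. r * pochhammer a n) u xs = u * prod_list (map (\<lambda>a. pochhammer a n) xs)"
    for u :: complex and xs n
    by (induction xs arbitrary: u) (simp_all add: mult.assoc)
  show ?thesis
    by (simp add: hypergeometric_def eval_fps_def *)
qed

text \<open>
  The continuous Hahn polynomial \<open>p\<^sub>n(x; a, b, cnj a, cnj b)\<close>; the two conjugate parameters
  are not repeated as arguments.
\<close>

definition continuous_hahn :: "nat \<Rightarrow> real \<Rightarrow> complex \<Rightarrow> complex \<Rightarrow> complex" where
  "continuous_hahn n x a b =
     \<i> ^ n * (pochhammer (of_real (2 * Re a)) n * pochhammer (a + cnj b) n / fact n) *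
     hypergeometric
       [- of_nat n, of_nat n + of_real (2 * Re a) + of_real (2 * Re b) - 1, a + \<i> * of_real x]
       [of_real (2 * Re a), a + cnj b] 1"

end

theory Submission
  imports Defs
begin

text \<open>
  Both sides are power series in \<open>\<i>\<rho>\<close>.  With \<open>\<alpha> = a + ix\<close> and \<open>\<beta> = cnj b - ix\<close>, the hypothesis
  \<open>Im a = Im b\<close> makes \<open>\<alpha> + \<beta>\<close> equal to \<open>Re a + Re b\<close>, and two applications of the Chu--Vandermonde sum turn
  the \<open>m\<close>-th coefficient of the Cauchy product of the two \<open>1F1\<close> into a multiple of
  \<open>p\<^sub>m(x; a, b, cnj a, cnj b)\<close>; this is the case \<open>b = c\<close>.  The general case follows by re-expanding
  \<open>p\<^sub>m(x; a, b, cnj a, cnj b)\<close> in the \<open>p\<^sub>k(x; a, c, cnj a, cnj c)\<close>.  As \<open>a\<close> and \<open>x\<close> enter both families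
  only through \<open>(\<alpha>)\<^sub>i / (2 Re a)\<^sub>i\<close>, the connection coefficients are those of the polynomials
  \<open>\<Sum>\<^sub>i (-m)\<^sub>i (m + 2\<nu>)\<^sub>i / ((\<nu> + 1/2)\<^sub>i i!) u\<^sup>i\<close>, i.e. of the Gegenbauer polynomials \<open>C\<^sub>m\<^sup>\<nu>(1 - 2u)\<close> with
  \<open>\<nu> = Re a + Re b - 1/2\<close> and \<open>\<mu> = Re a + Re c - 1/2\<close>, which only involve \<open>k = m - 2n\<close>.  A bound
  \<open>K\<^sup>m / m!\<close> for the terms of the double series over \<open>(k, n)\<close> allows summation along \<open>k + 2n = m\<close>.
\<close>

section \<open>Chu-Vandermonde sum and the Cauchy product of the two 1F1 series\<close>

lemma sum_choose_Suc:
  fixes h :: "nat \<Rightarrow> 'a::comm_ring_1"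
  shows "(\<Sum>l\<le>Suc N. of_nat (Suc N choose l) * h l) =
         (\<Sum>l\<le>N. of_nat (N choose l) * h l) + (\<Sum>l\<le>N. of_nat (N choose l) * h (Suc l))"
proof -
  have "(\<Sum>l\<le>N. of_nat (N choose l) * h l) = (\<Sum>l\<le>Suc N. of_nat (N choose l) * h l)"
    by (simp add: binomial_eq_0)
  also have "\<dots> = h 0 + (\<Sum>l\<le>N. of_nat (N choose Suc l) * h (Suc l))"
    by (subst sum.atMost_Suc_shift) simp
  finally show ?thesis
    by (subst sum.atMost_Suc_shift) (simp add: sum.distrib algebra_simps)
qed

text \<open>The classical value of 2F1(-N, x; s; 1) multiplied by (s)_N, hence free of division.
  Pascal's rule splits off a sum at (x + 1, s + 1), which has the same difference s - x; this is why
  x and s vary in the induction.\<close>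

lemma chu_vandermonde:
  fixes x s :: "'a::comm_ring_1"
  shows "(\<Sum>l\<le>N. of_nat (N choose l) * ((-1) ^ l * pochhammer x l * pochhammer (s + of_nat l) (N - l))) =
         pochhammer (s - x) N"
proof (induction N arbitrary: x s)
  case (Suc N)
  have "(\<Sum>l\<le>N. of_nat (N choose l) * ((-1) ^ l * pochhammer x l * pochhammer (s + of_nat l) (Suc N - l))) =
        (s + of_nat N) * (\<Sum>l\<le>N. of_nat (N choose l) * ((-1) ^ l * pochhammer x l * pochhammer (s + of_nat l) (N - l)))"
    unfolding sum_distrib_left
  proof (intro sum.cong refl)
    fix l assume "l \<in> {..N}"
    hence "Suc N - l = Suc (N - l)" "s + of_nat N = s + of_nat l + of_nat (N - l)"
      by (auto simp: of_nat_diff)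
    thus "of_nat (N choose l) * ((-1) ^ l * pochhammer x l * pochhammer (s + of_nat l) (Suc N - l)) =
        (s + of_nat N) * (of_nat (N choose l) * ((-1) ^ l * pochhammer x l * pochhammer (s + of_nat l) (N - l)))"
      by (simp only: pochhammer_Suc mult_ac)
  qed
  moreover have "(\<Sum>l\<le>N. of_nat (N choose l) * ((-1) ^ Suc l * pochhammer x (Suc l) * pochhammer (s + of_nat (Suc l)) (Suc N - Suc l))) =
        - x * (\<Sum>l\<le>N. of_nat (N choose l) * ((-1) ^ l * pochhammer (x + 1) l * pochhammer ((s + 1) + of_nat l) (N - l)))"
    unfolding sum_distrib_left
    by (intro sum.cong refl) (simp add: pochhammer_rec add_ac mult_ac)
  ultimately show ?case
    unfolding sum_choose_Suc Suc.IH by (simp add: pochhammer_Suc algebra_simps)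
qed auto

lemma pochhammer_minus_of_nat:
  assumes "i \<le> m"
  shows "pochhammer (- of_nat m :: 'a::field_char_0) i = (-1) ^ i * fact m / fact (m - i)"
proof -
  have "fact m = fact (m - i) * pochhammer (of_nat (m - i) + 1 :: 'a) i"
    using pochhammer_product[of "m - i" m "1 :: 'a"] assms by (simp add: pochhammer_fact add.commute)
  thus ?thesis using assms by (simp add: pochhammer_minus of_nat_diff)
qed

text \<open>The first Chu-Vandermonde sum expands (\<beta>)_(m-j) in the (\<alpha>+j)_l, which merge
  with (\<alpha>)_j into (\<alpha>)_i for i = j + l. For fixed i the remaining sum over j is the
  second one and produces (m+A+B-1)_i.\<close>

lemma hahn_cauchy_product:
  fixes \<alpha> \<beta> A B :: "'a::field_char_0"
  assumes "\<And>n. pochhammer A n \<noteq> 0" "\<And>n. pochhammer B n \<noteq> 0" "\<And>n. pochhammer (\<alpha> + \<beta>) n \<noteq> 0"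
  shows "(\<Sum>j\<le>m. (-1) ^ j * pochhammer \<alpha> j * pochhammer \<beta> (m - j) /
              (pochhammer A j * pochhammer B (m - j) * fact j * fact (m - j))) =
         pochhammer (\<alpha> + \<beta>) m / (pochhammer B m * fact m) *
         (\<Sum>i\<le>m. pochhammer (- of_nat m) i * pochhammer (of_nat m + A + B - 1) i * pochhammer \<alpha> i /
              (pochhammer A i * pochhammer (\<alpha> + \<beta>) i * fact i))"
proof -
  define s where "s = \<alpha> + \<beta>"
  define h where "h = (\<lambda>j l. (-1) ^ j * pochhammer \<alpha> j * (of_nat (m - j choose l) * ((-1) ^ l * pochhammer (\<alpha> + of_nat j) l *
     pochhammer (s + of_nat j + of_nat l) (m - j - l))) / (pochhammer A j * pochhammer B (m - j) * fact j * fact (m - j)))"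
  have "(\<Sum>j\<le>m. (-1) ^ j * pochhammer \<alpha> j * pochhammer \<beta> (m - j) /
              (pochhammer A j * pochhammer B (m - j) * fact j * fact (m - j))) = (\<Sum>j\<le>m. \<Sum>l\<le>m - j. h j l)"
  proof (intro sum.cong refl)
    fix j
    have b: "\<beta> = (s + of_nat j) - (\<alpha> + of_nat j)" by (simp add: s_def)
    show "(-1) ^ j * pochhammer \<alpha> j * pochhammer \<beta> (m - j) / (pochhammer A j * pochhammer B (m - j) * fact j * fact (m - j)) = (\<Sum>l\<le>m - j. h j l)"
      unfolding h_def sum_divide_distrib[symmetric] sum_distrib_left[symmetric] chu_vandermonde b[symmetric] ..
  qed
  also have "\<dots> = (\<Sum>(j,l)\<in>{(j,l). j + l \<le> m}. h j l)"
    by (subst sum.Sigma) (auto intro!: sum.cong)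
  also have "\<dots> = (\<Sum>i\<le>m. \<Sum>j\<le>i. h j (i - j))"
    by (rule sum.triangle_reindex_eq)
  also have "\<dots> = (\<Sum>i\<le>m. pochhammer s m / (pochhammer B m * fact m) *
       (pochhammer (- of_nat m) i * pochhammer (of_nat m + A + B - 1) i * pochhammer \<alpha> i /
              (pochhammer A i * pochhammer s i * fact i)))"
  proof (intro sum.cong refl)
    fix i assume "i \<in> {..m}"
    hence i: "i \<le> m" by simp
    define c where "c = (-1) ^ i * pochhammer \<alpha> i * pochhammer s m / (pochhammer s i * fact (m - i) * fact i * pochhammer A i * pochhammer B m)"
    have "h j (i - j) = c * (of_nat (i choose j) * ((-1) ^ j * pochhammer (1 - B - of_nat m) j * pochhammer (A + of_nat j) (i - j)))"
      if "j \<le> i" for j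
    proof -
      have 1: "pochhammer \<alpha> i = pochhammer \<alpha> j * pochhammer (\<alpha> + of_nat j) (i - j)"
        "pochhammer A i = pochhammer A j * pochhammer (A + of_nat j) (i - j)"
        "pochhammer s m = pochhammer s i * pochhammer (s + of_nat i) (m - i)"
        "pochhammer B m = pochhammer B (m - j) * pochhammer (B + of_nat (m - j)) j"
        using that i pochhammer_product[of j i] pochhammer_product[of i m] pochhammer_product[of "m - j" m B] by auto
      \<comment> \<open>The quotient (B)_m / (B)_(m-j) = (B+m-j)_j is reflected to the fixed base
        1-B-m, as Chu-Vandermonde requires.\<close>
      have 2: "(-1) ^ j * pochhammer (1 - B - of_nat m) j = pochhammer (B + of_nat (m - j)) j"
        using pochhammer_minus[of "B + of_nat m - 1" j] that i by (simp add: of_nat_diff algebra_simps)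
      have 3: "of_nat (m - j choose (i - j)) = (fact (m - j) / (fact (i - j) * fact (m - i)) :: 'a)"
        "of_nat (i choose j) = (fact i / (fact j * fact (i - j)) :: 'a)"
        using that i by (simp_all add: binomial_fact)
      have 4: "s + of_nat j + of_nat (i - j) = s + of_nat i" "m - j - (i - j) = m - i"
        using that i by (auto simp: of_nat_diff)
      have 5: "(-1) ^ i = ((-1) ^ j * (-1) ^ (i - j) :: 'a)"
        using that by (simp flip: power_add)
      have nz: "pochhammer A j \<noteq> 0" "pochhammer (A + of_nat j) (i - j) \<noteq> 0" "pochhammer B (m - j) \<noteq> 0" "pochhammer (B + of_nat (m - j)) j \<noteq> 0"
         "pochhammer s i \<noteq> 0"
        using assms(1)[of i] assms(2)[of m] assms(3)[of i] 1 by (auto simp: s_def)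
      show ?thesis
        unfolding c_def h_def 2 3 4 1 5 using nz by (simp add: divide_simps)
    qed
    hence "(\<Sum>j\<le>i. h j (i - j)) = c * (\<Sum>j\<le>i. of_nat (i choose j) * ((-1) ^ j * pochhammer (1 - B - of_nat m) j * pochhammer (A + of_nat j) (i - j)))"
      unfolding sum_distrib_left by (intro sum.cong) auto
    also have "\<dots> = c * pochhammer (of_nat m + A + B - 1) i"
      unfolding chu_vandermonde by (simp add: algebra_simps)
    also have "\<dots> = pochhammer s m / (pochhammer B m * fact m) *
       (pochhammer (- of_nat m) i * pochhammer (of_nat m + A + B - 1) i * pochhammer \<alpha> i /
              (pochhammer A i * pochhammer s i * fact i))"
      unfolding pochhammer_minus_of_nat[OF i] c_def by (simp add: mult_ac)
    finally show "(\<Sum>j\<le>i. h j (i - j)) = \<dots>" .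
  qed
  finally show ?thesis unfolding s_def sum_distrib_left .
qed

section \<open>Connection coefficients between Gegenbauer polynomials\<close>

text \<open>For \<mu> \<noteq> 0 this is (\<mu>+k)/\<mu> times (2\<mu>)_k/k!, the value of the
  Gegenbauer polynomial of degree k at 1. The sum form keeps its meaning at \<mu> = 0; at k = 0 the
  factor k removes the term with the truncated \<open>k - 1\<close>.\<close>

definition gegenbauer_weight :: "real \<Rightarrow> nat \<Rightarrow> real" where
  "gegenbauer_weight \<mu> k = (pochhammer (2 * \<mu> + 1) k + real k * pochhammer (2 * \<mu> + 1) (k - 1)) / fact k"

text \<open>
  If \<open>G\<^sub>m\<^sup>\<nu>\<close> denotes the multiple of \<open>C\<^sub>m\<^sup>\<nu>\<close> with value \<open>1\<close> at \<open>1\<close>, these are the coefficients of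
  \<open>G\<^sub>m\<^sup>\<nu> / m! = \<Sum>\<^sub>n gegenbauer_conn \<nu> \<mu> (m - 2n) n * G\<^sub>m\<^sub>-\<^sub>2\<^sub>n\<^sup>\<mu>\<close>.  The quotients \<open>(\<nu>)\<^sub>m\<^sub>-\<^sub>n / (2\<nu>)\<^sub>m\<close> and
  \<open>(2\<mu>)\<^sub>k / (\<mu>)\<^sub>k\<close> of the classical formula are written with a factor \<open>\<nu>\<close> resp. \<open>\<mu>\<close> cancelled, so that they
  keep their meaning at \<open>\<nu> = 0\<close> and \<open>\<mu> = 0\<close>.
\<close>

definition gegenbauer_conn :: "real \<Rightarrow> real \<Rightarrow> nat \<Rightarrow> nat \<Rightarrow> real" where
  "gegenbauer_conn \<nu> \<mu> k n =
     (if k + 2 * n = 0 then 1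
      else pochhammer (\<nu> + 1) (k + n - 1) / (2 * pochhammer (2 * \<nu> + 1) (k + 2 * n - 1))) *
     pochhammer (\<nu> - \<mu>) n * gegenbauer_weight \<mu> k / (pochhammer (\<mu> + 1) (k + n) * fact n)"

lemma gegenbauer_weight_0 [simp]: "gegenbauer_weight \<mu> 0 = 1"
  by (simp add: gegenbauer_weight_def)

lemma gegenbauer_weight_Suc: "gegenbauer_weight \<mu> (Suc k) = 2 * (\<mu> + real (Suc k)) * pochhammer (2 * \<mu> + 1) k / fact (Suc k)"
  by (simp add: gegenbauer_weight_def pochhammer_Suc algebra_simps add_divide_distrib)

text \<open>
  A WZ certificate for the sum of the connection coefficients: with \<open>N = k + 2n\<close>, the difference
  \<open>(N + 1) gegenbauer_conn \<nu> \<mu> (k + 1) n - gegenbauer_conn \<nu> \<mu> k n\<close> telescopes in \<open>n\<close>.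
\<close>

definition gegenbauer_conn_cert :: "real \<Rightarrow> real \<Rightarrow> nat \<Rightarrow> nat \<Rightarrow> real" where
  "gegenbauer_conn_cert \<nu> \<mu> N n =
     (if 2 * n \<le> N + 1 then
        real n * pochhammer (2 * \<mu> + 1) (N + 1 - 2 * n) * pochhammer (\<nu> + 1) (N - n) *
        pochhammer (\<nu> - \<mu>) n /
        (pochhammer (\<mu> + 1) (N + 1 - n) * fact n * fact (N + 1 - 2 * n) * pochhammer (2 * \<nu> + 1) N)
      else 0)"

lemma pochhammer_neq_0_of_pos: "(x::real) > 0 \<Longrightarrow> pochhammer x n \<noteq> 0"
  using pochhammer_pos[of x n] by simp

text \<open>The generic case, in which no default value occurs. All four terms are rational
  multiples of one hypergeometric term \<open>U\<close>, which leaves a polynomial identity.\<close>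

lemma gegenbauer_conn_cert_inner:
  assumes "\<nu> > -1/2" "\<mu> > -1/2"
  shows "real (Suc k + 2 * n + 1) * gegenbauer_conn \<nu> \<mu> (Suc (Suc k)) n - gegenbauer_conn \<nu> \<mu> (Suc k) n =
    gegenbauer_conn_cert \<nu> \<mu> (Suc k + 2 * n) n - gegenbauer_conn_cert \<nu> \<mu> (Suc k + 2 * n) (Suc n)"
proof -
  define U where "U = pochhammer (2 * \<mu> + 1) k * pochhammer (\<nu> + 1) (k + n) * pochhammer (\<nu> - \<mu>) n /
    (pochhammer (\<mu> + 1) (Suc (k + n)) * fact n * fact k * pochhammer (2 * \<nu> + 1) (k + 2 * n))"
  have nz: "pochhammer (\<mu> + 1) (k + n) \<noteq> 0" "pochhammer (2 * \<nu> + 1) (k + 2 * n) \<noteq> 0"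
    using assms by (auto intro!: pochhammer_neq_0_of_pos)
  have p: "2 * \<nu> + 1 + real k + 2 * real n > 0" "\<mu> + 1 + real k + real n > 0" "\<mu> + 2 + real k + real n > 0"
    using assms by auto
  have e1: "gegenbauer_conn \<nu> \<mu> (Suc (Suc k)) n = U * (\<nu> + 1 + real (k + n)) * (\<mu> + real (Suc (Suc k))) * (2 * \<mu> + 1 + real k) /
     ((2 * \<nu> + 1 + real (k + 2 * n)) * (\<mu> + 1 + real (Suc (k + n))) * real (Suc k) * real (Suc (Suc k)))"
    by (simp add: gegenbauer_conn_def U_def gegenbauer_weight_Suc pochhammer_Suc fact_Suc mult_ac del: of_nat_Suc of_nat_add distrib_left_numeral)
  have e2: "gegenbauer_conn \<nu> \<mu> (Suc k) n = U * (\<mu> + real k + 1) / (real k + 1)"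
    using nz p by (simp add: gegenbauer_conn_def U_def gegenbauer_weight_Suc pochhammer_Suc divide_simps) (simp add: algebra_simps)
  have s1: "Suc (k + 2 * n) - n = Suc (k + n)" "Suc (Suc (k + 2 * n)) - n = Suc (Suc (k + n))"
    "Suc (Suc (k + 2 * n)) - 2 * n = Suc (Suc k)" "k + 2 * n - n = k + n" by auto
  have e3: "gegenbauer_conn_cert \<nu> \<mu> (Suc k + 2 * n) n = U * (2 * \<mu> + 1 + real k) * (2 * \<mu> + 1 + real (Suc k)) *
      (\<nu> + 1 + real (k + n)) * real n / ((\<mu> + 1 + real (Suc (k + n))) * real (Suc k) * real (Suc (Suc k)) * (2 * \<nu> + 1 + real (k + 2 * n)))"
    by (simp add: gegenbauer_conn_cert_def U_def s1 pochhammer_Suc fact_Suc mult_ac add.commute[of n k] del: of_nat_Suc of_nat_add distrib_left_numeral)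
  have e4: "gegenbauer_conn_cert \<nu> \<mu> (Suc k + 2 * n) (Suc n) = U * (\<nu> - \<mu> + real n) / (2 * \<nu> + 1 + real k + 2 * real n)"
    using nz p by (simp add: gegenbauer_conn_cert_def U_def s1 pochhammer_Suc divide_simps)
  show ?thesis
    unfolding e1 e2 e3 e4 using p by (simp add: divide_simps) algebra
qed

text \<open>The end index n = N/2 > 0 for even N. The next certificate is 0 by definition, so only
  one appears on the right.\<close>

lemma gegenbauer_conn_cert_even:
  assumes "\<nu> > -1/2" "\<mu> > -1/2"
  shows "real (2 * Suc n + 1) * gegenbauer_conn \<nu> \<mu> (Suc 0) (Suc n) - gegenbauer_conn \<nu> \<mu> 0 (Suc n) =
    gegenbauer_conn_cert \<nu> \<mu> (2 * Suc n) (Suc n)"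
proof -
  define U where "U = pochhammer (\<nu> + 1) n * pochhammer (\<nu> - \<mu>) (Suc n) /
    (pochhammer (\<mu> + 1) (Suc n) * fact n * pochhammer (2 * \<nu> + 1) (Suc (2 * n)))"
  have nz: "pochhammer (\<mu> + 1) n \<noteq> 0" "pochhammer (2 * \<nu> + 1) (2 * n) \<noteq> 0"
    using assms by (auto intro!: pochhammer_neq_0_of_pos)
  have p: "2 * \<nu> + 1 + 2 * real n > 0" "2 * \<nu> + 2 + 2 * real n > 0" "\<mu> + 1 + real n > 0" "\<mu> + 2 + real n > 0"
    using assms by auto
  have e1: "gegenbauer_conn \<nu> \<mu> (Suc 0) (Suc n) = U / (2 * (real n + 1)) * (\<nu> + 1 + real n) * 2 * (\<mu> + 1) / ((2 * \<nu> + 2 + 2 * real n) * (\<mu> + 2 + real n))"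
    using nz p by (simp add: gegenbauer_conn_def U_def gegenbauer_weight_Suc pochhammer_Suc divide_simps) (simp add: algebra_simps)
  have e2: "gegenbauer_conn \<nu> \<mu> 0 (Suc n) = U / (2 * (real n + 1))"
    using nz p by (simp add: gegenbauer_conn_def U_def gegenbauer_weight_Suc pochhammer_Suc divide_simps)
  have e3: "gegenbauer_conn_cert \<nu> \<mu> (2 * Suc n) (Suc n) = U * (2 * \<mu> + 1) * (\<nu> + 1 + real n) / ((\<mu> + 2 + real n) * (2 * \<nu> + 2 + 2 * real n))"
    using nz p by (simp add: gegenbauer_conn_cert_def U_def pochhammer_Suc divide_simps) (simp add: algebra_simps)
  show ?thesis
    unfolding e1 e2 e3 using p by (simp add: divide_simps) algebra
qed

text \<open>The index with 2n = N + 1 is new in the sum for N + 1, so there is no term for N to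
  subtract.\<close>

lemma gegenbauer_conn_cert_odd:
  assumes "\<nu> > -1/2" "\<mu> > -1/2"
  shows "real (2 * Suc n) * gegenbauer_conn \<nu> \<mu> 0 (Suc n) = gegenbauer_conn_cert \<nu> \<mu> (Suc (2 * n)) (Suc n)"
proof -
  have nz: "pochhammer (\<mu> + 1) n \<noteq> 0" "pochhammer (2 * \<nu> + 1) (2 * n) \<noteq> 0"
    using assms by (auto intro!: pochhammer_neq_0_of_pos)
  have p: "2 * \<nu> + 1 + 2 * real n > 0" "\<mu> + 1 + real n > 0"
    using assms by auto
  show ?thesis
    using nz p by (simp add: gegenbauer_conn_def gegenbauer_conn_cert_def pochhammer_Suc divide_simps)
qed

text \<open>The connection formula at argument 1, where all normalised polynomials equal 1. Summing
  the certificate identity over n gives (N+1) S(N+1) = S(N) for N > 0; S(0) and S(1) are computed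
  directly.\<close>

lemma gegenbauer_conn_sum_at_1:
  assumes "\<nu> > -1/2" "\<mu> > -1/2"
  shows "(\<Sum>n\<le>m div 2. gegenbauer_conn \<nu> \<mu> (m - 2 * n) n) = 1 / fact m"
proof -
  define F where "F = (\<lambda>N n. if 2 * n \<le> N then gegenbauer_conn \<nu> \<mu> (N - 2 * n) n else 0)"
  have F_sum: "(\<Sum>n\<le>m div 2. gegenbauer_conn \<nu> \<mu> (m - 2 * n) n) = (\<Sum>n<M. F m n)" if "m < M" for m M
    using that by (intro sum.mono_neutral_cong_left) (auto simp: F_def)
  have step: "real (N + 1) * F (N + 1) n - F N n = gegenbauer_conn_cert \<nu> \<mu> N n - gegenbauer_conn_cert \<nu> \<mu> N (Suc n)"
    if "N > 0" for N n
  proof -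
    \<comment> \<open>Interior index, end index for even N, index first occurring at N + 1, and
      indices at which all terms vanish.\<close>
    consider k where "N = Suc k + 2 * n" | n' where "n = Suc n'" "N = 2 * n"
      | n' where "n = Suc n'" "N = Suc (2 * n')" | "N + 1 < 2 * n"
    proof -
      have "N > 2 * n \<or> N = 2 * n \<or> N + 1 = 2 * n \<or> N + 1 < 2 * n" by linarith
      thus ?thesis
        using that \<open>N > 0\<close>
      proof (elim disjE)
        assume "N > 2 * n"
        then obtain d where "N = Suc (2 * n + d)" using less_imp_Suc_add by blast
        thus ?thesis using that(1)[of d] by simp
      next
        assume "N = 2 * n"
        thus ?thesis using that(2)[of "n - 1"] \<open>N > 0\<close> by simp
      next
        assume "N + 1 = 2 * n"
        thus ?thesis using that(3)[of "n - 1"] by simp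
      qed (use that(4) in simp)
    qed
    thus ?thesis
    proof cases
      case 1 thus ?thesis using gegenbauer_conn_cert_inner[OF assms, of k n] by (simp add: F_def Suc_diff_le)
    next
      case 2 thus ?thesis using gegenbauer_conn_cert_even[OF assms, of n'] by (simp add: F_def gegenbauer_conn_cert_def[of _ _ _ "Suc (Suc n')"])
    next
      case 3 thus ?thesis using gegenbauer_conn_cert_odd[OF assms, of n'] by (simp add: F_def gegenbauer_conn_cert_def[of _ _ _ "Suc (Suc n')"])
    next
      case 4 thus ?thesis by (simp add: F_def gegenbauer_conn_cert_def)
    qed
  qed
  have "(\<Sum>n<M. F m n) = 1 / fact m" if "m < M" for m M
    using that
  proof (induction m arbitrary: M)
    case 0
    have "(\<Sum>n<M. F 0 n) = gegenbauer_conn \<nu> \<mu> 0 0"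
      using F_sum[OF 0] by simp
    thus ?case by (simp add: gegenbauer_conn_def)
  next
    case (Suc m)
    show ?case
    proof (cases "m = 0")
      case True
      have "(\<Sum>n<M. F (Suc m) n) = gegenbauer_conn \<nu> \<mu> 1 0"
        using F_sum[OF Suc.prems] True by simp
      thus ?thesis using True assms by (simp add: gegenbauer_conn_def gegenbauer_weight_Suc)
    next
      case False
      have "(\<Sum>n<M. real (m + 1) * F (m + 1) n - F m n) =
            (\<Sum>n<M. gegenbauer_conn_cert \<nu> \<mu> m n - gegenbauer_conn_cert \<nu> \<mu> m (Suc n))"
        using False by (intro sum.cong step) auto
      also have "\<dots> = gegenbauer_conn_cert \<nu> \<mu> m 0 - gegenbauer_conn_cert \<nu> \<mu> m M"
        by (rule sum_lessThan_telescope')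
      \<comment> \<open>The first certificate has the factor n = 0, the last is 0 because 2M > m +
        1.\<close>
      also have "\<dots> = 0"
        using Suc.prems by (simp add: gegenbauer_conn_cert_def)
      finally have "real (Suc m) * (\<Sum>n<M. F (Suc m) n) = 1 / fact m"
        using Suc.IH[of M] Suc.prems by (simp add: sum_subtractf flip: sum_distrib_left)
      hence "(\<Sum>n<M. F (Suc m) n) = 1 / fact m / real (Suc m)"
        by (simp add: eq_divide_eq mult_ac)
      thus ?thesis by (simp add: mult.commute)
    qed
  qed
  thus ?thesis using F_sum[of m "Suc m"] by (simp del: sum.lessThan_Suc)
qed

text \<open>Differentiation in u turns the polynomial of degree d and parameter \<mu> into
  -d(d+2\<mu>)/(\<mu>+1/2) times that of degree d - 1 and parameter \<mu>+1. The identity matches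
  these factors on both sides of the connection formula, with d = \<open>Suc k\<close>; on the \<nu>
  side one factor m = d + 2n is absorbed by 1/m!.\<close>

lemma gegenbauer_conn_shift:
  assumes "\<nu> > -1/2" "\<mu> > -1/2"
  shows "gegenbauer_conn \<nu> \<mu> (Suc k) n * (real (Suc k) * (real (Suc k) + 2 * \<mu>) / (\<mu> + 1/2)) =
         gegenbauer_conn (\<nu> + 1) (\<mu> + 1) k n * ((real (Suc k + 2 * n) + 2 * \<nu>) / (\<nu> + 1/2))"
proof -
  define r where "r = (\<lambda>\<nu>::real. if k + 2 * n = 0 then 1
      else pochhammer (\<nu> + 1) (k + n - 1) / (2 * pochhammer (2 * \<nu> + 1) (k + 2 * n - 1)) :: real)"
  have 1: "pochhammer (\<nu> + 1) (k + n) / (2 * pochhammer (2 * \<nu> + 1) (k + 2 * n)) =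
     r (\<nu> + 1) * ((real (Suc k + 2 * n) + 2 * \<nu>) / (2 * (2 * \<nu> + 1)))"
  proof (cases "k + 2 * n = 0")
    case True thus ?thesis using assms by (simp add: r_def)
  next
    case False
    then obtain j where j: "k + n = Suc j" by (metis add_is_0 mult_0_right not0_implies_Suc)
    obtain m where m: "k + 2 * n = Suc m" using False not0_implies_Suc by blast
    have a: "pochhammer (\<nu> + 1) (k + n) = (\<nu> + 1) * pochhammer (\<nu> + 2) j"
      unfolding j by (simp add: pochhammer_rec add.commute)
    \<comment> \<open>One Pochhammer symbol is peeled at the top and at the bottom, which relates
      base 2\<nu>+1 to base 2\<nu>+3.\<close>
    have "pochhammer (2 * \<nu> + 1) (Suc m) * (2 * \<nu> + 1 + real (Suc m)) = pochhammer (2 * \<nu> + 1) (Suc (Suc m))"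
      by (simp add: pochhammer_Suc)
    also have "\<dots> = (2 * \<nu> + 1) * (2 * \<nu> + 2) * pochhammer (2 * \<nu> + 3) m"
      by (simp add: pochhammer_rec algebra_simps)
    finally have b: "pochhammer (2 * \<nu> + 1) (k + 2 * n) * (2 * \<nu> + 1 + real (Suc m)) = (2 * \<nu> + 1) * (2 * \<nu> + 2) * pochhammer (2 * \<nu> + 3) m"
      unfolding m .
    have nz: "pochhammer (2 * \<nu> + 3) m \<noteq> 0" "pochhammer (2 * \<nu> + 1) (k + 2 * n) \<noteq> 0"
      using assms by (auto intro!: pochhammer_neq_0_of_pos)
    have p: "2 * \<nu> + 1 + real (Suc m) > 0" "2 * \<nu> + 1 > 0" "2 * \<nu> + 2 > 0" using assms by auto
    have b': "pochhammer (2 * \<nu> + 1) (k + 2 * n) = (2 * \<nu> + 1) * (2 * \<nu> + 2) * pochhammer (2 * \<nu> + 3) m / (2 * \<nu> + 1 + real (Suc m))"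
      using b p by (simp add: field_simps)
    have r: "r (\<nu> + 1) = pochhammer (\<nu> + 2) j / (2 * pochhammer (2 * \<nu> + 3) m)"
      using False j m by (simp add: r_def add.commute algebra_simps)
    have rm: "real (Suc k + 2 * n) = real (Suc m) + 1" using m by linarith
    show ?thesis unfolding a b' r rm using nz p by (simp add: divide_simps) algebra
  qed
  have 2: "gegenbauer_weight \<mu> (Suc k) * (real (Suc k) * (real (Suc k) + 2 * \<mu>) / (\<mu> + 1/2)) = 4 * (\<mu> + 1) * gegenbauer_weight (\<mu> + 1) k"
  proof (cases k)
    case 0 thus ?thesis using assms by (simp add: gegenbauer_weight_Suc divide_simps) (simp add: algebra_simps)
  next
    case (Suc j)
    have "pochhammer (2 * \<mu> + 1) (Suc j) * (2 * \<mu> + 1 + real (Suc j)) = pochhammer (2 * \<mu> + 1) (Suc (Suc j))"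
      by (simp add: pochhammer_Suc)
    also have "\<dots> = (2 * \<mu> + 1) * (2 * \<mu> + 2) * pochhammer (2 * \<mu> + 3) j"
      by (simp add: pochhammer_rec algebra_simps)
    finally have b: "pochhammer (2 * \<mu> + 1) (Suc j) * (2 * \<mu> + 1 + real (Suc j)) = (2 * \<mu> + 1) * (2 * \<mu> + 2) * pochhammer (2 * \<mu> + 3) j" .
    have p: "2 * \<mu> + 1 + real (Suc j) > 0" "2 * \<mu> + 1 > 0" using assms by auto
    have b': "pochhammer (2 * \<mu> + 1) (Suc j) = (2 * \<mu> + 1) * (2 * \<mu> + 2) * pochhammer (2 * \<mu> + 3) j / (2 * \<mu> + 1 + real (Suc j))"
      using b p by (simp add: field_simps)
    have c: "2 * (\<mu> + 1) + 1 = 2 * \<mu> + 3" by simp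
    show ?thesis unfolding Suc gegenbauer_weight_Suc b' c using p by (simp add: divide_simps fact_Suc del: of_nat_Suc) (simp add: algebra_simps)
  qed
  have 3: "pochhammer (\<mu> + 1) (Suc k + n) = (\<mu> + 1) * pochhammer (\<mu> + 2) (k + n)"
    by (simp add: pochhammer_rec add.commute)
  have nz: "pochhammer (\<mu> + 2) (k + n) \<noteq> 0" "\<mu> + 1 > 0"
    using assms by (auto intro!: pochhammer_neq_0_of_pos)
  have L: "gegenbauer_conn \<nu> \<mu> (Suc k) n * (real (Suc k) * (real (Suc k) + 2 * \<mu>) / (\<mu> + 1/2)) =
     (pochhammer (\<nu> + 1) (k + n) / (2 * pochhammer (2 * \<nu> + 1) (k + 2 * n))) * pochhammer (\<nu> - \<mu>) n *
     (gegenbauer_weight \<mu> (Suc k) * (real (Suc k) * (real (Suc k) + 2 * \<mu>) / (\<mu> + 1/2))) / (pochhammer (\<mu> + 1) (Suc k + n) * fact n)"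
    by (simp add: gegenbauer_conn_def mult_ac)
  have R: "gegenbauer_conn (\<nu> + 1) (\<mu> + 1) k n = r (\<nu> + 1) * pochhammer (\<nu> - \<mu>) n * gegenbauer_weight (\<mu> + 1) k / (pochhammer (\<mu> + 2) (k + n) * fact n)"
    by (simp add: gegenbauer_conn_def r_def add.commute)
  have "\<nu> + 1/2 = (2 * \<nu> + 1) / 2" by simp
  show ?thesis
    unfolding L R 1 2 3 using nz assms by (simp add: divide_simps del: of_nat_Suc) (simp add: algebra_simps)
qed

text \<open>Comparison of the coefficients of u^i in the connection formula, up to the common 1/i!.
  The value at u = 0 starts the induction; each step is one differentiation, replacing (\<nu>,
  \<mu>, m) by (\<nu>+1, \<mu>+1, m-1).\<close>

lemma gegenbauer_conn_sum:
  assumes "\<nu> > -1/2" "\<mu> > -1/2"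
  shows "(\<Sum>n\<le>m div 2. gegenbauer_conn \<nu> \<mu> (m - 2 * n) n *
            (pochhammer (- real (m - 2 * n)) i * pochhammer (real (m - 2 * n) + 2 * \<mu>) i / pochhammer (\<mu> + 1/2) i)) =
         pochhammer (- real m) i * pochhammer (real m + 2 * \<nu>) i / (pochhammer (\<nu> + 1/2) i * fact m)"
  using assms
proof (induction i arbitrary: \<nu> \<mu> m)
  case 0 thus ?case by (simp add: gegenbauer_conn_sum_at_1)
next
  case (Suc i)
  define g where "g = (\<lambda>\<mu> i k. pochhammer (- real k) i * pochhammer (real k + 2 * \<mu>) i / pochhammer (\<mu> + 1/2) i)"
  have g0: "g \<mu> (Suc i) 0 = 0" for \<mu> by (simp add: g_def pochhammer_rec)
  have gS: "g \<mu> (Suc i) (Suc k) = - (real (Suc k) * (real (Suc k) + 2 * \<mu>) / (\<mu> + 1/2)) * g (\<mu> + 1) i k" for k \<mu>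
    by (simp add: g_def pochhammer_rec add_ac)
  show ?case
  proof (cases m)
    case 0
    thus ?thesis by (simp add: pochhammer_rec)
  next
    case (Suc m')
    \<comment> \<open>For even m the summand n = m/2 has degree 0, so its derivative
      vanishes.\<close>
    have "(\<Sum>n\<le>m div 2. gegenbauer_conn \<nu> \<mu> (m - 2 * n) n * g \<mu> (Suc i) (m - 2 * n)) =
          (\<Sum>n\<le>m' div 2. gegenbauer_conn \<nu> \<mu> (m - 2 * n) n * g \<mu> (Suc i) (m - 2 * n))"
    proof (intro sum.mono_neutral_right ballI)
      fix n assume "n \<in> {..m div 2} - {..m' div 2}"
      hence "m - 2 * n = 0" using Suc by auto
      thus "gegenbauer_conn \<nu> \<mu> (m - 2 * n) n * g \<mu> (Suc i) (m - 2 * n) = 0" by (simp only: g0)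
    qed (use Suc in \<open>auto simp: div_le_mono\<close>)
    also have "\<dots> = (\<Sum>n\<le>m' div 2. - ((real m + 2 * \<nu>) / (\<nu> + 1/2)) * (gegenbauer_conn (\<nu> + 1) (\<mu> + 1) (m' - 2 * n) n * g (\<mu> + 1) i (m' - 2 * n)))"
    proof (intro sum.cong refl)
      fix n assume "n \<in> {..m' div 2}"
      hence n: "2 * n \<le> m'" by auto
      hence e: "m - 2 * n = Suc (m' - 2 * n)" "real (Suc (m' - 2 * n) + 2 * n) = real m" using Suc by auto
      show "gegenbauer_conn \<nu> \<mu> (m - 2 * n) n * g \<mu> (Suc i) (m - 2 * n) = - ((real m + 2 * \<nu>) / (\<nu> + 1/2)) * (gegenbauer_conn (\<nu> + 1) (\<mu> + 1) (m' - 2 * n) n * g (\<mu> + 1) i (m' - 2 * n))"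
        using arg_cong[OF gegenbauer_conn_shift[OF Suc.prems, of "m' - 2 * n" n], of "\<lambda>t. - t * g (\<mu> + 1) i (m' - 2 * n)"]
        unfolding e gS by (simp only: mult_ac mult_minus_left mult_minus_right)
    qed
    also have "\<dots> = - ((real m + 2 * \<nu>) / (\<nu> + 1/2)) * (pochhammer (- real m') i * pochhammer (real m' + 2 * (\<nu> + 1)) i / (pochhammer (\<nu> + 1 + 1/2) i * fact m'))"
      unfolding sum_distrib_left[symmetric] g_def using Suc.prems by (subst Suc.IH) auto
    also have "\<dots> = pochhammer (- real m) (Suc i) * pochhammer (real m + 2 * \<nu>) (Suc i) / (pochhammer (\<nu> + 1/2) (Suc i) * fact m)"
    proof -
      have 1: "pochhammer (- real m) (Suc i) = - real m * pochhammer (- real m') i"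
        "pochhammer (real m + 2 * \<nu>) (Suc i) = (real m + 2 * \<nu>) * pochhammer (real m' + 2 * (\<nu> + 1)) i"
        "pochhammer (\<nu> + 1/2) (Suc i) = (\<nu> + 1/2) * pochhammer (\<nu> + 1 + 1/2) i"
        "fact m = real m * fact m'"
        by (simp_all add: Suc pochhammer_rec add_ac)
      have "real m \<noteq> 0" using Suc by simp
      thus ?thesis unfolding 1 by simp
    qed
    finally show ?thesis unfolding g_def .
  qed
qed

section \<open>Growth bounds for the terms of the double series\<close>

text \<open>Holds factor by factor: norm (z + n) \<le> K (p + n) once K \<ge> 1 and K p \<ge> norm
  z.\<close>

lemma pochhammer_ratio_bound:
  fixes z :: "'a::real_normed_field"
  assumes "p > 0"
  obtains K where "K \<ge> 1" "\<And>n. norm (pochhammer z n) \<le> K ^ n * pochhammer p n"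
proof
  define K where "K = max 1 (norm z / p)"
  show K: "K \<ge> 1" by (simp add: K_def)
  have Kp: "norm z \<le> K * p"
    using assms by (simp add: K_def max_def field_simps)
  show "norm (pochhammer z n) \<le> K ^ n * pochhammer p n" for n
  proof (induction n)
    case (Suc n)
    have "norm (z + of_nat n) \<le> norm z + real n"
      by (metis norm_triangle_ineq norm_of_nat)
    also have "\<dots> \<le> K * p + K * real n"
      using Kp K by (intro add_mono) (auto simp: mult_le_cancel_right1)
    finally have "norm (z + of_nat n) \<le> K * (p + real n)" by (simp add: algebra_simps)
    from mult_mono[OF Suc.IH this] show ?case
      using K assms by (simp add: pochhammer_Suc norm_mult mult_ac pochhammer_nonneg)
  qed simp
qed

text \<open>The base moves with k, so the dependence on k is made explicit: (1 + k)_i is i! times a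
  binomial coefficient, which is at most 2^(k+i).\<close>

lemma norm_pochhammer_shift_le:
  fixes z :: "'a::real_normed_field"
  shows "norm (pochhammer (z + of_nat k) i) \<le> (norm z + 1) ^ i * 2 ^ (k + i) * fact i"
proof -
  have "norm (pochhammer (z + of_nat k) i) \<le> (norm z + 1) ^ i * pochhammer (1 + real k) i"
  proof (induction i)
    case (Suc i)
    have "norm (z + of_nat k + of_nat i) \<le> norm z + real k + real i"
      by (smt (verit) norm_triangle_ineq norm_of_nat)
    also have "\<dots> \<le> (norm z + 1) * (1 + real k + real i)"
      by (simp add: algebra_simps)
    finally have "norm (z + of_nat k + of_nat i) \<le> (norm z + 1) * (1 + real k + real i)" .
    from mult_mono[OF Suc.IH this] show ?case
      by (simp add: pochhammer_Suc norm_mult mult_ac pochhammer_nonneg)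
  qed simp
  also have "(norm z + 1) ^ i * pochhammer (1 + real k) i \<le> (norm z + 1) ^ i * (2 ^ (k + i) * fact i)"
  proof (intro mult_left_mono)
    have "pochhammer (1 + real k) i = real (k + i choose i) * fact i"
      using pochhammer_product[of k "k + i" "1 :: real"]
      by (simp add: pochhammer_fact[symmetric] binomial_fact)
    also have "real (k + i choose i) \<le> real (2 ^ (k + i))"
      unfolding of_nat_le_iff by (rule binomial_le_pow2)
    finally show "pochhammer (1 + real k) i \<le> 2 ^ (k + i) * fact i" by simp
  qed auto
  finally show ?thesis by (simp only: mult_ac)
qed

text \<open>Up to sign (-k)_i/i! is a binomial coefficient, and these sum to 2^k; the remaining
  quotient is at most L^k.\<close>

lemma terminating_3F2_bound:
  fixes \<alpha> z :: complex and p q :: real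
  assumes "p > 0" "q > 0"
  obtains K where "K \<ge> 1"
    "\<And>k. norm (\<Sum>i\<le>k. pochhammer (- of_nat k) i * pochhammer (z + of_nat k) i * pochhammer \<alpha> i /
              (pochhammer (of_real p) i * pochhammer (of_real q) i * fact i)) \<le> K ^ k"
proof -
  obtain K1 where K1: "K1 \<ge> 1" "\<And>n. norm (pochhammer \<alpha> n) \<le> K1 ^ n * pochhammer p n"
    using pochhammer_ratio_bound[OF assms(1)] by metis
  obtain K2 where K2: "K2 \<ge> 1" "\<And>n. norm (pochhammer (1::real) n) \<le> K2 ^ n * pochhammer q n"
    using pochhammer_ratio_bound[OF assms(2)] by metis
  define w where "w = norm z + 1"
  have w: "w \<ge> 1" by (simp add: w_def)
  \<comment> \<open>The 4 collects 2^k and 2^i from \<open>norm_pochhammer_shift_le\<close>;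
    \<open>K2\<close> trades i! for (q)_i.\<close>
  define L where "L = 4 * w * K1 * K2"
  have prod1: "1 \<le> x * y" if "1 \<le> x" "1 \<le> y" for x y :: real
    using mult_mono[OF that] that by simp
  have L: "L \<ge> 1"
    unfolding L_def using K1(1) K2(1) w by (intro prod1) auto
  have "norm (\<Sum>i\<le>k. pochhammer (- of_nat k) i * pochhammer (z + of_nat k) i * pochhammer \<alpha> i /
              (pochhammer (of_real p) i * pochhammer (of_real q) i * fact i)) \<le> (2 * L) ^ k" for k
  proof -
    have "norm (\<Sum>i\<le>k. pochhammer (- of_nat k) i * pochhammer (z + of_nat k) i * pochhammer \<alpha> i /
              (pochhammer (of_real p) i * pochhammer (of_real q) i * fact i))
          \<le> (\<Sum>i\<le>k. real (k choose i) * L ^ k)"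
    proof (rule sum_norm_le)
      fix i assume "i \<in> {..k}"
      hence i: "i \<le> k" by simp
      have pos: "pochhammer p i > 0" "pochhammer q i > 0"
        using assms by (auto intro: pochhammer_pos)
      have "pochhammer (- of_nat k) i / fact i = (-1) ^ i * (of_nat (k choose i) :: complex)"
        unfolding pochhammer_minus_of_nat[OF i] using i by (simp add: binomial_fact)
      hence 1: "pochhammer (- of_nat k) i * pochhammer (z + of_nat k) i * pochhammer \<alpha> i /
              (pochhammer (of_real p) i * pochhammer (of_real q) i * fact i) =
            (-1) ^ i * of_nat (k choose i) * (pochhammer (z + of_nat k) i * pochhammer \<alpha> i /
              (pochhammer (of_real p) i * pochhammer (of_real q) i))"
        by (simp add: field_simps)
      have "norm (pochhammer (z + of_nat k) i) * norm (pochhammer \<alpha> i)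
            \<le> (w ^ i * 2 ^ (k + i) * fact i) * (K1 ^ i * pochhammer p i)"
        using K1(1) by (intro mult_mono norm_pochhammer_shift_le[of z, folded w_def] K1) (use w in auto)
      also have "\<dots> \<le> (w ^ i * 2 ^ (k + i) * (K2 ^ i * pochhammer q i)) * (K1 ^ i * pochhammer p i)"
        using K1(1) K2(2)[of i] pos w by (intro mult_right_mono mult_left_mono) (auto simp: pochhammer_fact)
      also have "\<dots> = (2 ^ k * (2 * w * K1 * K2) ^ i) * (pochhammer p i * pochhammer q i)"
        by (simp add: power_add power_mult_distrib mult_ac)
      also have "\<dots> \<le> L ^ k * (pochhammer p i * pochhammer q i)"
      proof (intro mult_right_mono)
        have "(2 * w * K1 * K2) ^ i \<le> (2 * w * K1 * K2) ^ k"
          using K1(1) K2(1) i w by (intro power_increasing prod1) auto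
        hence "2 ^ k * (2 * w * K1 * K2) ^ i \<le> 2 ^ k * (2 * w * K1 * K2) ^ k"
          by (intro mult_left_mono) auto
        also have "\<dots> = L ^ k" by (simp add: L_def mult_ac flip: power_mult_distrib)
        finally show "2 ^ k * (2 * w * K1 * K2) ^ i \<le> L ^ k" .
      qed (use pos in auto)
      finally have "norm (pochhammer (z + of_nat k) i * pochhammer \<alpha> i /
              (pochhammer (of_real p) i * pochhammer (of_real q) i)) \<le> L ^ k"
        using pos by (simp add: norm_mult norm_divide pochhammer_of_real field_simps)
      hence "real (k choose i) * norm (pochhammer (z + of_nat k) i * pochhammer \<alpha> i /
              (pochhammer (of_real p) i * pochhammer (of_real q) i)) \<le> real (k choose i) * L ^ k"
        by (intro mult_left_mono) auto
      thus "norm (pochhammer (- of_nat k) i * pochhammer (z + of_nat k) i * pochhammer \<alpha> i /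
              (pochhammer (of_real p) i * pochhammer (of_real q) i * fact i)) \<le> real (k choose i) * L ^ k"
        unfolding 1 by (simp add: norm_mult norm_power norm_divide)
    qed
    also have "\<dots> = (2 * L) ^ k"
      by (simp add: power_mult_distrib choose_row_sum flip: sum_distrib_right of_nat_sum)
    finally show ?thesis .
  qed
  thus ?thesis using that[of "2 * L"] L by simp
qed

text \<open>With m = k + 2n, the decay 1/m! stems from (2\<nu>+1)_(m-1) in the denominator; all
  other quotients are geometric by \<open>pochhammer_ratio_bound\<close>.\<close>

lemma gegenbauer_conn_bound:
  assumes "\<nu> > -1/2" "\<mu> > -1/2"
  obtains K where "K \<ge> 1" "\<And>k n. \<bar>gegenbauer_conn \<nu> \<mu> k n\<bar> \<le> K ^ (k + 2 * n) / fact (k + 2 * n)"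
proof -
  have p: "\<mu> + 1 > 0" "2 * \<nu> + 1 > 0" "2 * \<mu> + 1 > 0" "\<nu> + 1 > 0" using assms by auto
  obtain K1 where K1: "K1 \<ge> 1" "\<And>n. norm (pochhammer (\<nu> + 1) n) \<le> K1 ^ n * pochhammer (\<mu> + 1) n"
    using pochhammer_ratio_bound[OF p(1)] by metis
  obtain K2 where K2: "K2 \<ge> 1" "\<And>n. norm (pochhammer (1::real) n) \<le> K2 ^ n * pochhammer (2 * \<nu> + 1) n"
    using pochhammer_ratio_bound[OF p(2)] by metis
  obtain K3 where K3: "K3 \<ge> 1" "\<And>n. norm (pochhammer (\<nu> - \<mu>) n) \<le> K3 ^ n * pochhammer 1 n"
    using pochhammer_ratio_bound[of 1] by (metis zero_less_one)
  obtain K4 where K4: "K4 \<ge> 1" "\<And>n. norm (pochhammer (2 * \<mu> + 1) n) \<le> K4 ^ n * pochhammer 1 n"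
    using pochhammer_ratio_bound[of 1] by (metis zero_less_one)
  have gegenbauer_weight: "\<bar>gegenbauer_weight \<mu> k\<bar> \<le> (2 * K4) ^ k" for k
  proof (cases k)
    case (Suc j)
    have "0 \<le> pochhammer (2 * \<mu> + 1) i" for i using p by (simp add: pochhammer_nonneg)
    hence "\<bar>gegenbauer_weight \<mu> k\<bar> = (pochhammer (2 * \<mu> + 1) k + real k * pochhammer (2 * \<mu> + 1) j) / fact k"
      by (simp add: gegenbauer_weight_def Suc)
    also have "\<dots> \<le> (K4 ^ k * fact k + real k * (K4 ^ j * fact j)) / fact k"
      using K4(2)[of k] K4(2)[of j] p by (intro divide_right_mono add_mono mult_left_mono) (auto simp flip: pochhammer_fact)
    also have "\<dots> = K4 ^ k + K4 ^ j" by (simp add: Suc add_divide_distrib del: of_nat_Suc)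
    also have "\<dots> \<le> 2 * K4 ^ k" using K4(1) power_increasing[of j k K4] by (simp add: Suc)
    also have "\<dots> \<le> 2 ^ k * K4 ^ k" using K4(1) by (intro mult_right_mono) (auto simp: Suc)
    finally show ?thesis by (simp add: power_mult_distrib)
  qed auto
  define K where "K = K1 * K2 * K3 * (2 * K4)"
  have prod1: "1 \<le> x * y" if "1 \<le> x" "1 \<le> y" for x y :: real
    using mult_mono[OF that] that by simp
  have "\<bar>gegenbauer_conn \<nu> \<mu> k n\<bar> \<le> K ^ (k + 2 * n) / fact (k + 2 * n)" for k n
  proof -
    define m where "m = k + 2 * n"
    define r where "r = (if m = 0 then 1 else pochhammer (\<nu> + 1) (k + n - 1) / (2 * pochhammer (2 * \<nu> + 1) (m - 1)))"
    have pp: "pochhammer (\<nu> + 1) j > 0" "pochhammer (2 * \<nu> + 1) j > 0" "pochhammer (\<mu> + 1) j > 0" for j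
      using p by (auto intro: pochhammer_pos)
    have r0: "r \<ge> 0" using pp by (simp add: r_def less_imp_le)
    \<comment> \<open>For m > 0, raising both indices by one multiplies \<open>r\<close> by
      2(\<nu>+1+j)/(2\<nu>+1+i) with j = k + n - 1 and i = m - 1; this is at least 1 because i \<le>
      2j + 1.\<close>
    have "r \<le> pochhammer (\<nu> + 1) (k + n) / pochhammer (2 * \<nu> + 1) m"
    proof (cases "m = 0")
      case True thus ?thesis by (simp add: r_def m_def)
    next
      case False
      then obtain j where j: "k + n = Suc j" unfolding m_def by (metis add_is_0 mult_0_right not0_implies_Suc)
      obtain i where i: "m = Suc i" using False not0_implies_Suc by blast
      have ij: "real i \<le> 2 * real j + 1" using i j unfolding m_def by linarith
      have "pochhammer (2 * \<nu> + 1) m = pochhammer (2 * \<nu> + 1) i * (2 * \<nu> + 1 + real i)"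
        by (simp add: i pochhammer_Suc)
      also have "\<dots> \<le> pochhammer (2 * \<nu> + 1) i * (2 * (\<nu> + 1 + real j))"
        using ij pp(2)[of i] by (intro mult_left_mono) auto
      finally have "pochhammer (\<nu> + 1) j * pochhammer (2 * \<nu> + 1) m \<le>
         pochhammer (\<nu> + 1) j * (pochhammer (2 * \<nu> + 1) i * (2 * (\<nu> + 1 + real j)))"
        using pp(1)[of j] by (intro mult_left_mono) auto
      also have "\<dots> = pochhammer (\<nu> + 1) (k + n) * (2 * pochhammer (2 * \<nu> + 1) i)"
        by (simp add: j pochhammer_Suc mult_ac)
      finally have "pochhammer (\<nu> + 1) j / (2 * pochhammer (2 * \<nu> + 1) i) \<le> pochhammer (\<nu> + 1) (k + n) / pochhammer (2 * \<nu> + 1) m"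
        using pp(2)[of i] pp(2)[of m] by (simp add: divide_simps mult_ac)
      thus ?thesis by (simp add: r_def i j)
    qed
    also have "\<dots> \<le> (K1 ^ (k + n) * pochhammer (\<mu> + 1) (k + n)) / (fact m / K2 ^ m)"
      using K1(2)[of "k + n"] K2(2)[of m] K2(1) pp(1)[of "k + n"] pp(2)[of m] pp(3)[of "k + n"] K1(1)
      by (intro frac_le) (auto simp: divide_simps mult_ac simp flip: pochhammer_fact)
    finally have r1: "r \<le> (K1 ^ (k + n) * pochhammer (\<mu> + 1) (k + n)) * K2 ^ m / fact m" by simp
    have "\<bar>gegenbauer_conn \<nu> \<mu> k n\<bar> = r * \<bar>pochhammer (\<nu> - \<mu>) n\<bar> * \<bar>gegenbauer_weight \<mu> k\<bar> / (pochhammer (\<mu> + 1) (k + n) * fact n)"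
      unfolding gegenbauer_conn_def r_def[symmetric, unfolded m_def] using r0 pp(3)[of "k + n"] by (simp add: abs_mult m_def r_def)
    also have "\<dots> \<le> ((K1 ^ (k + n) * pochhammer (\<mu> + 1) (k + n)) * K2 ^ m / fact m) * (K3 ^ n * fact n) * (2 * K4) ^ k
           / (pochhammer (\<mu> + 1) (k + n) * fact n)"
      using r1 r0 gegenbauer_weight[of k] K3(2)[of n] K4(1) K1(1) K2(1) K3(1) pp(3)[of "k + n"]
      by (intro divide_right_mono mult_mono) (auto simp flip: pochhammer_fact)
    also have "\<dots> = K1 ^ (k + n) * K2 ^ m * K3 ^ n * (2 * K4) ^ k / fact m"
      using pp(3)[of "k + n"] by (simp add: field_simps)
    also have "\<dots> \<le> K1 ^ m * K2 ^ m * K3 ^ m * (2 * K4) ^ m / fact m"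
      using K1(1) K2(1) K3(1) K4(1)
      by (intro divide_right_mono mult_mono power_increasing) (auto simp: m_def)
    also have "\<dots> = K ^ m / fact m" by (simp add: K_def power_mult_distrib)
    finally show ?thesis by (simp add: m_def)
  qed
  moreover have "K \<ge> 1" unfolding K_def using K1(1) K2(1) K3(1) K4(1) by (intro prod1) auto
  ultimately show ?thesis using that by blast
qed

section \<open>Summation along diagonals\<close>

text \<open>As k! n! \<le> (k + 2n)!, the product of the exponential series of K and K^2
  dominates.\<close>

lemma summable_on_diagonal_bound:
  fixes f :: "nat \<Rightarrow> nat \<Rightarrow> complex"
  assumes "K \<ge> 0" and bound: "\<And>k n. norm (f k n) \<le> K ^ (k + 2 * n) / fact (k + 2 * n)"
  shows "(\<lambda>(k, n). f k n) summable_on UNIV"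
proof -
  define g where "g = (\<lambda>k. K ^ k / fact k)"
  define h where "h = (\<lambda>n. (K\<^sup>2) ^ n / fact n)"
  have gs: "g summable_on UNIV" "h summable_on UNIV"
    using summable_exp[of K] summable_exp[of "K\<^sup>2"] assms(1)
    by (auto simp: g_def h_def summable_on_UNIV_nonneg_real_iff divide_inverse mult.commute)
  have nonneg: "g k \<ge> 0" "h k \<ge> 0" for k
    using assms(1) by (auto simp: g_def h_def)
  have "(\<lambda>(k, n). g k * h n) summable_on UNIV \<times> UNIV"
  proof (rule summable_on_SigmaI)
    show "((\<lambda>n. case (k, n) of (k, n) \<Rightarrow> g k * h n) has_sum g k * infsum h UNIV) UNIV" for k
      using has_sum_cmult_right[OF has_sum_infsum[OF gs(2)], of "g k"] by simp
    show "(\<lambda>k. g k * infsum h UNIV) summable_on UNIV"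
      by (rule summable_on_cmult_left[OF gs(1)])
  qed (use nonneg in auto)
  hence "(\<lambda>(k, n). norm (f k n)) summable_on UNIV"
    unfolding UNIV_Times_UNIV
  proof (rule summable_on_comparison_test)
    fix x :: "nat \<times> nat"
    obtain k n where x: "x = (k, n)" by force
    have "fact k * fact n \<le> (fact (k + n) :: nat)"
      by (intro dvd_imp_le fact_fact_dvd_fact) auto
    also have "\<dots> \<le> fact (k + 2 * n)" by (intro fact_mono) auto
    finally have "real (fact k * fact n) \<le> real (fact (k + 2 * n))" by (simp only: of_nat_le_iff)
    hence "K ^ (k + 2 * n) / fact (k + 2 * n) \<le> K ^ (k + 2 * n) / (fact k * fact n)"
      using assms(1) by (intro divide_left_mono) auto
    also have "\<dots> = g k * h n" by (simp add: g_def h_def power_add power_mult)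
    finally show "(case x of (k, n) \<Rightarrow> norm (f k n)) \<le> (case x of (k, n) \<Rightarrow> g k * h n)"
      using bound[of k n] by (simp add: x)
  qed auto
  hence "(\<lambda>x. norm (case x of (k, n) \<Rightarrow> f k n)) summable_on UNIV"
    by (simp only: case_prod_unfold)
  thus ?thesis by (rule abs_summable_summable)
qed

text \<open>Unconditional summability permits both groupings: by rows k, and along k + 2n = m via
  the bijection (m, n) -> (m - 2n, n).\<close>

lemma sums_rearrange_diagonal:
  fixes f :: "nat \<Rightarrow> nat \<Rightarrow> complex"
  assumes "(\<lambda>(k, n). f k n) summable_on UNIV"
    and diag: "(\<lambda>m. \<Sum>n\<le>m div 2. f (m - 2 * n) n) sums s"
  shows "(\<lambda>k. \<Sum>n. f k n) sums s" "\<And>k. summable (f k)"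
proof -
  obtain t where t: "((\<lambda>(k, n). f k n) has_sum t) UNIV"
    using assms(1) by (auto simp: summable_on_def)
  define D where "D = (SIGMA m:UNIV. {..m div 2::nat})"
  have bij: "bij_betw (\<lambda>(m, n). (m - 2 * n, n)) D UNIV"
    unfolding D_def by (rule bij_betwI[where g = "\<lambda>(k, n). (k + 2 * n, n)"]) auto
  have "((\<lambda>(m, n). f (m - 2 * n) n) has_sum t) D"
    using has_sum_reindex_bij_betw[OF bij, of "\<lambda>(k, n). f k n"] t by (simp add: case_prod_unfold)
  hence "((\<lambda>m. \<Sum>n\<le>m div 2. f (m - 2 * n) n) has_sum t) UNIV"
    unfolding D_def by (rule has_sum_SigmaD) (auto intro!: has_sum_finite)
  from has_sum_imp_sums[OF this] diag have "t = s" by (rule sums_unique2)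
  have fk: "f k summable_on UNIV" for k
    using summable_on_SigmaD1[where A = UNIV and B = "\<lambda>_. UNIV" and f = f and x = k] assms(1) by (simp add: case_prod_unfold)
  have su: "(f k has_sum suminf (f k)) UNIV" for k
    using has_sum_infsum[OF fk[of k]] sums_unique[OF has_sum_imp_sums[OF has_sum_infsum[OF fk[of k]]]] by simp
  show "summable (f k)" for k using sums_summable[OF has_sum_imp_sums[OF su]] .
  have "((\<lambda>k. \<Sum>n. f k n) has_sum t) UNIV"
    by (rule has_sum_SigmaD[where B = "\<lambda>_. UNIV" and f = "\<lambda>(k, n). f k n"]) (use t su in auto)
  from has_sum_imp_sums[OF this] show "(\<lambda>k. \<Sum>n. f k n) sums s" using \<open>t = s\<close> by simp
qed

section \<open>Duplication formulas and the coefficients of the 4F5\<close>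

text \<open>The duplication formula for index 2j + 2 with the last factor \<nu>+1+j
  cancelled.\<close>

lemma pochhammer_double_odd:
  fixes \<nu> :: real
  assumes "\<nu> > -1/2"
  shows "2 * pochhammer (2 * \<nu> + 1) (Suc (2 * j)) =
         4 ^ Suc j * pochhammer (\<nu> + 1/2) (Suc j) * pochhammer (\<nu> + 1) j"
proof -
  have "pochhammer (2 * \<nu> + 1) (2 * Suc j) = 4 ^ Suc j * pochhammer (\<nu> + 1/2) (Suc j) * pochhammer (\<nu> + 1) (Suc j)"
  proof -
    have "of_nat (2 ^ (2 * Suc j)) = (4 :: real) ^ Suc j" by (simp only: power_mult) simp
    moreover have "2 * (\<nu> + 1/2) = 2 * \<nu> + 1" "\<nu> + 1/2 + 1/2 = \<nu> + 1" by simp_all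
    ultimately show ?thesis using pochhammer_double[of "\<nu> + 1/2" "Suc j"] by metis
  qed
  moreover have "pochhammer (2 * \<nu> + 1) (2 * Suc j) = 2 * pochhammer (2 * \<nu> + 1) (Suc (2 * j)) * (\<nu> + 1 + real j)"
    by (simp add: pochhammer_Suc algebra_simps)
  moreover have "\<nu> + 1 + real j \<noteq> 0" using assms by (simp add: add_nonneg_eq_0_iff)
  ultimately show ?thesis
    by (simp add: pochhammer_Suc[of "\<nu> + 1" j])
qed

text \<open>With k = j + 1, the symbols (2\<nu>+1)_(k-1) and (2\<nu>+k)_k join to (2\<nu>+1)_(2k-1).
  This evaluates the symbols (k+2\<nu>)_k in the coefficients of the theorem.\<close>

lemma pochhammer_shift_Suc:
  fixes \<nu> :: real
  assumes "\<nu> > -1/2"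
  shows "2 * pochhammer (2 * \<nu> + real (Suc j)) (Suc j) * pochhammer (2 * \<nu> + 1) j =
         4 ^ Suc j * pochhammer (\<nu> + 1/2) (Suc j) * pochhammer (\<nu> + 1) j"
  using pochhammer_double_odd[OF assms, of j] pochhammer_product[of j "Suc (2 * j)" "2 * \<nu> + 1"]
  by (simp add: algebra_simps)

lemma pochhammer_half:
  "pochhammer (z / 2) n * pochhammer ((z + 1) / 2) n = pochhammer (z :: real) (2 * n) / 4 ^ n"
  using pochhammer_double[of "z / 2" n] by (simp add: power_mult add_divide_distrib)

text \<open>
  For \<open>k = 0\<close> the upper parameter \<open>p + q + k - 1/2\<close> always equals the lower parameter
  \<open>p + q + (k - 1)/2\<close>; cancelling them covers the degenerate case \<open>p + q = 1/2\<close> as well.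
\<close>

definition coeff_4F5 :: "real \<Rightarrow> real \<Rightarrow> real \<Rightarrow> nat \<Rightarrow> nat \<Rightarrow> real" where
  "coeff_4F5 p q r k n =
     pochhammer ((p + q + real k) / 2) n * pochhammer ((p + q + real k + 1) / 2) n *
     (if k = 0 then 1 else pochhammer (p + q + real k - 1/2) n / pochhammer (p + q + (real k - 1) / 2) n) *
     pochhammer (q - r) n /
     (pochhammer (p + q + real k / 2) n * pochhammer (q + real k / 2) n * pochhammer (q + (real k + 1) / 2) n *
      pochhammer (p + r + real k + 1/2) n * fact n)"

text \<open>Matches the terms of the theorem with those of the double series, apart from powers of
  \<open>\<i> * \<rho>\<close>. The second factor on the left is the prefactor of p_k, and 4^n comes
  from the argument -\<rho>^2/4. Parameters differing by 1/2 are paired by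
  \<open>pochhammer_half\<close>.\<close>

lemma coeff_4F5_conn:
  assumes pqr: "p > 0" "q > 0" "r > 0"
  shows "pochhammer (real k + 2 * p + 2 * q - 1) k /
      (pochhammer (2 * p) k * pochhammer (2 * q) k * pochhammer (real k + 2 * p + 2 * r - 1) k) *
      (pochhammer (2 * p) k * pochhammer (p + r) k / fact k) * (coeff_4F5 p q r k n / 4 ^ n) =
    pochhammer (p + q) (k + 2 * n) / pochhammer (2 * q) (k + 2 * n) * gegenbauer_conn (p + q - 1/2) (p + r - 1/2) k n"
proof (cases k)
  case 0
  define \<nu> where "\<nu> = p + q - 1/2"
  have \<nu>: "\<nu> > -1/2" "p + q = \<nu> + 1/2" using pqr by (auto simp: \<nu>_def)
  \<comment> \<open>At k = 0 two parameters are already cancelled in \<open>coeff_4F5\<close>; what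
    remains of their pairing is (p+q)_n = (\<nu>+1/2)_n.\<close>
  have r: "(if n = 0 then 1 else pochhammer (\<nu> + 1) (n - 1) / (2 * pochhammer (2 * \<nu> + 1) (2 * n - 1))) =
      1 / (4 ^ n * pochhammer (\<nu> + 1/2) n)"
  proof (cases n)
    case (Suc j)
    have "pochhammer (\<nu> + 1) j \<noteq> 0" using \<nu> by (intro pochhammer_neq_0_of_pos) auto
    thus ?thesis using pochhammer_double_odd[OF \<nu>(1), of j] by (simp add: Suc)
  qed simp
  have F: "coeff_4F5 p q r 0 n = (pochhammer (p + q) (2 * n) / 4 ^ n) * pochhammer (q - r) n /
       (pochhammer (p + q) n * (pochhammer (2 * q) (2 * n) / 4 ^ n) * pochhammer (p + r + 1/2) n * fact n)"
    using pochhammer_half[of "p + q" n] pochhammer_half[of "2 * q" n]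
    by (simp add: coeff_4F5_def add_divide_distrib mult.assoc[symmetric])
  have C: "gegenbauer_conn \<nu> (p + r - 1/2) 0 n = 1 / (4 ^ n * pochhammer (\<nu> + 1/2) n) * pochhammer (q - r) n / (pochhammer (p + r + 1/2) n * fact n)"
    unfolding r[symmetric] by (simp add: gegenbauer_conn_def \<nu>_def add_ac)
  show ?thesis
    unfolding 0 F \<nu>_def[symmetric] C by (simp add: \<nu>(2))
next
  case (Suc j)
  define \<nu> \<mu> where "\<nu> = p + q - 1/2" and "\<mu> = p + r - 1/2"
  have \<nu>: "\<nu> > -1/2" "\<mu> > -1/2" using pqr by (auto simp: \<nu>_def \<mu>_def)
  define m where "m = k + 2 * n"
  define d where "d = pochhammer (2 * \<nu> + real k) (2 * n)"
  define e where "e = pochhammer (2 * \<nu> + real k) k"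
  \<comment> \<open>Here k \<ge> 1 gives 2\<nu> + k > 0, which can fail for k = 0.\<close>
  have pos: "pochhammer (2 * \<nu> + 1) i > 0" "pochhammer (2 * \<mu> + 1) i > 0" "pochhammer (\<nu> + 1) i > 0"
    "pochhammer (\<mu> + 1) i > 0" "pochhammer (\<nu> + 1/2) i > 0" "pochhammer (\<mu> + 1/2) i > 0"
    "pochhammer (2 * p) i > 0" "pochhammer (2 * q) i > 0" "pochhammer (2 * q + real k) i > 0" "pochhammer (p + q) i > 0"
    "pochhammer (2 * \<nu> + real k) i > 0" "pochhammer (2 * \<mu> + real k) i > 0" "pochhammer (\<mu> + 1 + real k) i > 0"
    "pochhammer (\<nu> + 1/2 + real k) i > 0" for i
    using \<nu> pqr by (auto intro!: pochhammer_pos simp: Suc)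
  have m1: "m - 1 = j + 2 * n" "k + n - 1 = j + n" "m \<noteq> 0" by (auto simp: m_def Suc)
  have s1: "pochhammer (p + q) m = pochhammer (p + q) k * pochhammer (p + q + real k) (2 * n)"
    "pochhammer (2 * q) m = pochhammer (2 * q) k * pochhammer (2 * q + real k) (2 * n)"
    "pochhammer (2 * \<nu> + 1) (m - 1) = pochhammer (2 * \<nu> + 1) j * d"
    "pochhammer (\<nu> + 1) (j + n) = pochhammer (\<nu> + 1) j * pochhammer (\<nu> + real k) n"
    "pochhammer (\<mu> + 1) (k + n) = pochhammer (\<mu> + 1) j * (\<mu> + real k) * pochhammer (\<mu> + 1 + real k) n"
    using pochhammer_product[of k m "p + q"] pochhammer_product[of k m "2 * q"]
      pochhammer_product[of j "j + 2 * n" "2 * \<nu> + 1"] pochhammer_product[of j "j + n" "\<nu> + 1"]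
      pochhammer_product[of k "k + n" "\<mu> + 1"] pochhammer_Suc[of "\<mu> + 1" j] unfolding m1
    by (simp_all add: m_def d_def Suc add_ac)
  have F: "coeff_4F5 p q r k n = (pochhammer (p + q + real k) (2 * n) / 4 ^ n) * pochhammer (\<nu> + real k) n *
      pochhammer (\<nu> - \<mu>) n / ((d / 4 ^ n) * (pochhammer (2 * q + real k) (2 * n) / 4 ^ n) * pochhammer (\<mu> + 1 + real k) n * fact n)"
  proof -
    have "q + real k / 2 = (2 * q + real k) / 2" "q + (real k + 1) / 2 = (2 * q + real k + 1) / 2"
      "p + q + (real k - 1) / 2 = (2 * \<nu> + real k) / 2" "p + q + real k / 2 = (2 * \<nu> + real k + 1) / 2"
      "p + q + real k - 1/2 = \<nu> + real k" "q - r = \<nu> - \<mu>" "p + r + real k + 1/2 = \<mu> + 1 + real k"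
      by (auto simp: \<nu>_def \<mu>_def field_simps)
    thus ?thesis
      unfolding coeff_4F5_def d_def pochhammer_half[symmetric] using \<open>k = Suc j\<close> by (simp only: nat.distinct if_False) simp
  qed
  have C: "gegenbauer_conn \<nu> \<mu> k n = pochhammer (\<nu> + 1) (j + n) / (2 * pochhammer (2 * \<nu> + 1) (m - 1)) *
     pochhammer (\<nu> - \<mu>) n * (2 * (\<mu> + real k) * pochhammer (2 * \<mu> + 1) j / fact k) / (pochhammer (\<mu> + 1) (k + n) * fact n)"
    unfolding gegenbauer_conn_def m_def[symmetric] m1 using gegenbauer_weight_Suc[of \<mu> j] m1 by (simp add: Suc)
  have e1: "e = 4 ^ k * pochhammer (\<nu> + 1/2) k * pochhammer (\<nu> + 1) j / (2 * pochhammer (2 * \<nu> + 1) j)"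
    using pochhammer_shift_Suc[OF \<nu>(1), of j] pos(1)[of j] by (simp add: e_def Suc field_simps)
  have e2: "pochhammer (2 * \<mu> + real k) k = 4 ^ k * pochhammer (\<mu> + 1/2) k * pochhammer (\<mu> + 1) j / (2 * pochhammer (2 * \<mu> + 1) j)"
    using pochhammer_shift_Suc[OF \<nu>(2), of j] pos(2)[of j] by (simp add: Suc field_simps)
  have par: "real k + 2 * p + 2 * q - 1 = 2 * \<nu> + real k" "real k + 2 * p + 2 * r - 1 = 2 * \<mu> + real k"
    "p + q - 1/2 = \<nu>" "p + r - 1/2 = \<mu>"
    by (auto simp: \<nu>_def \<mu>_def)
  have par': "p + r = \<mu> + 1/2" "p + q = \<nu> + 1/2"
    by (auto simp: \<nu>_def \<mu>_def)
  have nz: "pochhammer (2 * \<nu> + 1) j \<noteq> 0" "pochhammer (2 * \<mu> + 1) j \<noteq> 0" "pochhammer (\<nu> + 1) j \<noteq> 0"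
    "pochhammer (\<mu> + 1) j \<noteq> 0" "pochhammer (\<nu> + 1/2) k \<noteq> 0" "pochhammer (\<mu> + 1/2) k \<noteq> 0"
    "pochhammer (2 * p) k \<noteq> 0" "pochhammer (2 * q) k \<noteq> 0" "pochhammer (2 * q + real k) (2 * n) \<noteq> 0"
    "pochhammer (\<nu> + 1/2 + real k) (2 * n) \<noteq> 0"
    "d \<noteq> 0" "pochhammer (\<mu> + 1 + real k) n \<noteq> 0" "\<mu> + real k \<noteq> 0"
    using pos \<nu> unfolding d_def by (auto simp: less_imp_neq[symmetric] Suc add_nonneg_eq_0_iff)
  show ?thesis
    unfolding par m_def[symmetric] C F s1 e_def[symmetric] e1 e2 unfolding par'
    using nz by (simp add: divide_simps)
qed

section \<open>Series forms of the functions involved, and the expansion itself\<close>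

lemma hypergeometric_1F1_sums:
  fixes \<alpha> z :: complex and p :: real
  assumes "p > 0"
  defines "f \<equiv> \<lambda>n. pochhammer \<alpha> n / pochhammer (complex_of_real p) n * (z ^ n / fact n)"
  shows "summable (\<lambda>n. norm (f n))" "hypergeometric [\<alpha>] [of_real p] z = (\<Sum>n. f n)"
proof -
  obtain K where K: "K \<ge> 1" "\<And>n. norm (pochhammer \<alpha> n) \<le> K ^ n * pochhammer p n"
    using pochhammer_ratio_bound[OF assms(1)] by metis
  have "norm (norm (f n)) \<le> (K * norm z) ^ n / fact n" for n
  proof -
    have p: "pochhammer p n > 0" using assms(1) by (rule pochhammer_pos)
    have "norm (pochhammer \<alpha> n) / pochhammer p n \<le> K ^ n"
      using K(2)[of n] p by (simp add: divide_simps)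
    hence "norm (pochhammer \<alpha> n) / pochhammer p n * (norm z ^ n / fact n) \<le> K ^ n * (norm z ^ n / fact n)"
      by (rule mult_right_mono) auto
    thus ?thesis using p
      by (simp add: f_def norm_mult norm_divide norm_power pochhammer_of_real power_mult_distrib)
  qed
  moreover have "summable (\<lambda>n. (K * norm z) ^ n / fact n)"
    using summable_exp[of "K * norm z"] by (simp add: divide_inverse mult.commute)
  ultimately show "summable (\<lambda>n. norm (f n))"
    by (rule summable_comparison_test'[rotated])
  show "hypergeometric [\<alpha>] [of_real p] z = (\<Sum>n. f n)"
    by (simp add: hypergeometric_altdef f_def)
qed

text \<open>Equal imaginary parts make a + cnj c real, and (-k)_i = 0 for i > k terminates the
  series.\<close>

lemma continuous_hahn_altdef:
  assumes "Im a = Im c"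
  shows "continuous_hahn k x a c =
    \<i> ^ k * of_real (pochhammer (2 * Re a) k * pochhammer (Re a + Re c) k / fact k) *
    (\<Sum>i\<le>k. pochhammer (- of_nat k) i * pochhammer (of_real (2 * Re a + 2 * Re c - 1) + of_nat k) i * pochhammer (a + \<i> * of_real x) i /
              (pochhammer (of_real (2 * Re a)) i * pochhammer (of_real (Re a + Re c)) i * fact i))"
proof -
  have ac: "a + cnj c = of_real (Re a + Re c)"
    using assms by (simp add: complex_eq_iff)
  have z: "of_nat k + of_real (2 * Re a) + of_real (2 * Re c) - 1 = of_real (2 * Re a + 2 * Re c - 1) + (of_nat k :: complex)"
    by simp
  have "hypergeometric [- of_nat k, of_nat k + of_real (2 * Re a) + of_real (2 * Re c) - 1, a + \<i> * of_real x]
       [of_real (2 * Re a), a + cnj c] 1 =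
       (\<Sum>i. pochhammer (- of_nat k) i * pochhammer (of_real (2 * Re a + 2 * Re c - 1) + of_nat k) i * pochhammer (a + \<i> * of_real x) i /
              (pochhammer (of_real (2 * Re a)) i * pochhammer (of_real (Re a + Re c)) i * fact i))"
    unfolding hypergeometric_altdef z ac by (simp add: mult_ac)
  also have "\<dots> = (\<Sum>i\<le>k. pochhammer (- of_nat k) i * pochhammer (of_real (2 * Re a + 2 * Re c - 1) + of_nat k) i * pochhammer (a + \<i> * of_real x) i /
              (pochhammer (of_real (2 * Re a)) i * pochhammer (of_real (Re a + Re c)) i * fact i))"
    by (rule suminf_finite) (auto simp: pochhammer_of_nat_eq_0_iff)
  finally have H: "hypergeometric [- of_nat k, of_nat k + of_real (2 * Re a) + of_real (2 * Re c) - 1, a + \<i> * of_real x]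
       [of_real (2 * Re a), a + cnj c] 1 = \<dots>" .
  have P: "pochhammer (of_real (2 * Re a)) k * pochhammer (of_real (Re a + Re c)) k / fact k =
        complex_of_real (pochhammer (2 * Re a) k * pochhammer (Re a + Re c) k / fact k)"
    by (simp only: pochhammer_of_real) simp
  show ?thesis
    unfolding continuous_hahn_def H unfolding ac P ..
qed

lemma hypergeometric_4F5_altdef:
  assumes "p > 0" "q > 0"
  shows "(if k = 0 \<and> p + q = 1/2
              then hypergeometric
                (map complex_of_real [(p + q + real k) / 2, (p + q + real k + 1) / 2, q - r])
                (map complex_of_real [p + q + real k / 2, q + real k / 2, q + (real k + 1) / 2, p + r + real k + 1/2]) z
              else hypergeometric
                (map complex_of_real [(p + q + real k) / 2, (p + q + real k + 1) / 2, p + q + real k - 1/2, q - r])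
                (map complex_of_real [p + q + (real k - 1) / 2, p + q + real k / 2, q + real k / 2, q + (real k + 1) / 2, p + r + real k + 1/2]) z)
         = (\<Sum>n. of_real (coeff_4F5 p q r k n) * z ^ n)"
proof -
  \<comment> \<open>As p + q - 1/2 > -1/2, the only non-positive integer it can equal is 0.\<close>
  have nz: "pochhammer (p + q - 1/2) n \<noteq> 0" if "p + q \<noteq> 1/2" for n
  proof
    assume "pochhammer (p + q - 1/2) n = 0"
    then obtain j where "p + q - 1/2 = - real j" by (auto simp: pochhammer_eq_0_iff)
    thus False using that assms by (cases j) auto
  qed
  show ?thesis
  proof (cases "k = 0")
    case True
    show ?thesis
    proof (cases "p + q = 1/2")
      case True
      thus ?thesis unfolding hypergeometric_altdef \<open>k = 0\<close>
        by (simp add: pochhammer_of_real del: of_real_add of_real_diff of_real_divide of_real_mult)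
          (simp add: coeff_4F5_def mult_ac)
    next
      case False
      have "p + q + (real 0 - 1) / 2 = p + q - 1/2" "p + q + real 0 - 1/2 = p + q - 1/2" by auto
      thus ?thesis using False nz[OF False] unfolding hypergeometric_altdef True
        by (simp add: pochhammer_of_real del: of_nat_0 of_real_add of_real_diff of_real_divide of_real_mult)
          (simp add: coeff_4F5_def mult_ac)
    qed
  next
    case False
    thus ?thesis unfolding hypergeometric_altdef
      by (simp add: pochhammer_of_real del: of_real_add of_real_diff of_real_divide of_real_mult)
          (simp add: coeff_4F5_def mult_ac)
  qed
qed

(* For k = 0 and Re a + Re b = 1/2 the 4F5 has the upper parameter Re a + Re b + k - 1/2 and the
   lower parameter Re a + Re b + (k - 1)/2 both equal to 0; there these two equal parameters
   are cancelled.  This is the only case in which a lower parameter is in {0, -1, -2, ...}. *)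
theorem theorem4p3:
  fixes \<rho> a b c :: complex and x :: real
  assumes "Re a > 0" and "Re b > 0" and "Re c > 0"
    and "Im a = Im b" and "Im b = Im c"
  shows
    "(\<lambda>k. complex_of_real
             (pochhammer (real k + 2 * Re a + 2 * Re b - 1) k /
              (pochhammer (2 * Re a) k * pochhammer (2 * Re b) k *
               pochhammer (real k + 2 * Re a + 2 * Re c - 1) k))
           * \<rho> ^ k * continuous_hahn k x a c
           * (if k = 0 \<and> Re a + Re b = 1/2
              then hypergeometric
                (map complex_of_real
                  [(Re a + Re b + real k) / 2, (Re a + Re b + real k + 1) / 2,
                   Re b - Re c])
                (map complex_of_real
                  [Re a + Re b + real k / 2,
                   Re b + real k / 2, Re b + (real k + 1) / 2, Re a + Re c + real k + 1/2])
                (- (\<rho>\<^sup>2) / 4)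
              else hypergeometric
                (map complex_of_real
                  [(Re a + Re b + real k) / 2, (Re a + Re b + real k + 1) / 2,
                   Re a + Re b + real k - 1/2, Re b - Re c])
                (map complex_of_real
                  [Re a + Re b + (real k - 1) / 2, Re a + Re b + real k / 2,
                   Re b + real k / 2, Re b + (real k + 1) / 2, Re a + Re c + real k + 1/2])
                (- (\<rho>\<^sup>2) / 4)))
     sums
       (hypergeometric [a + \<i> * of_real x] [of_real (2 * Re a)] (- \<i> * \<rho>) *
        hypergeometric [cnj b - \<i> * of_real x] [of_real (2 * Re b)] (\<i> * \<rho>))"
proof -
  define p q r where "p = Re a" and "q = Re b" and "r = Re c"
  have pqr: "p > 0" "q > 0" "r > 0" using assms by (auto simp: p_def q_def r_def)
  define \<alpha> \<beta> where "\<alpha> = a + \<i> * of_real x" and "\<beta> = cnj b - \<i> * of_real x"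
  have \<alpha>\<beta>: "\<alpha> + \<beta> = of_real (p + q)"
    using assms by (simp add: \<alpha>_def \<beta>_def p_def q_def complex_eq_iff)
  define \<nu> \<mu> where "\<nu> = p + q - 1/2" and "\<mu> = p + r - 1/2"
  have \<nu>: "\<nu> > -1/2" "\<mu> > -1/2" using pqr by (auto simp: \<nu>_def \<mu>_def)
  \<comment> \<open>\<open>\<Phi>\<close> is the 3F2 in p_k(x; a, c, cnj a, cnj c). \<open>R\<close>
    comes from the prefactor in \<open>hahn_cauchy_product\<close>, whose 1/m! is contained in
    \<open>gegenbauer_conn\<close>. \<open>D\<close> is the term of the double series.\<close>
  define t where "t = (\<lambda>k i. pochhammer (- of_nat k) i * pochhammer (of_real (2 * \<mu>) + of_nat k) i * pochhammer \<alpha> i /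
              (pochhammer (of_real (2 * p)) i * pochhammer (of_real (p + r)) i * fact i))"
  define \<Phi> where "\<Phi> = (\<lambda>k. \<Sum>i\<le>k. t k i)"
  define R where "R = (\<lambda>m::nat. pochhammer (p + q) m / pochhammer (2 * q) m)"
  define D where "D = (\<lambda>k n. (\<i> * \<rho>) ^ (k + 2 * n) * of_real (R (k + 2 * n) * gegenbauer_conn \<nu> \<mu> k n) * \<Phi> k)"
  define A B where "A = (\<lambda>n. pochhammer \<alpha> n / pochhammer (of_real (2 * p)) n * ((- \<i> * \<rho>) ^ n / fact n))"
    and "B = (\<lambda>n. pochhammer \<beta> n / pochhammer (of_real (2 * q)) n * ((\<i> * \<rho>) ^ n / fact n))"

  have summ: "(\<lambda>(k, n). D k n) summable_on UNIV"
  proof -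
    obtain K1 where K1: "K1 \<ge> 1" "\<And>n. norm (pochhammer (p + q) n) \<le> K1 ^ n * pochhammer (2 * q) n"
      using pochhammer_ratio_bound[of "2 * q" "p + q"] pqr by auto
    obtain K2 where K2: "K2 \<ge> 1" "\<And>k n. \<bar>gegenbauer_conn \<nu> \<mu> k n\<bar> \<le> K2 ^ (k + 2 * n) / fact (k + 2 * n)"
      using gegenbauer_conn_bound[OF \<nu>] by metis
    obtain K3 where K3: "K3 \<ge> 1" "\<And>k. norm (\<Phi> k) \<le> K3 ^ k"
      using terminating_3F2_bound[of "2 * p" "p + r" "of_real (2 * \<mu>)" \<alpha>] pqr unfolding \<Phi>_def t_def by auto
    show ?thesis
    proof (rule summable_on_diagonal_bound[where K = "norm \<rho> * K1 * K2 * K3"])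
      fix k n :: nat
      define m where "m = k + 2 * n"
      have pos: "pochhammer (2 * q) m > 0" using pqr by (auto intro: pochhammer_pos)
      have R: "\<bar>R m\<bar> \<le> K1 ^ m" using K1(2)[of m] pos by (simp add: R_def divide_simps)
      have "norm (D k n) = norm \<rho> ^ m * (\<bar>R m\<bar> * \<bar>gegenbauer_conn \<nu> \<mu> k n\<bar>) * norm (\<Phi> k)"
        by (simp add: D_def norm_mult norm_power m_def abs_mult)
      also have "\<dots> \<le> norm \<rho> ^ m * (K1 ^ m * (K2 ^ m / fact m)) * K3 ^ k"
        using R K2(2)[of k n] K1(1) K2(1) K3 unfolding m_def by (intro mult_mono) auto
      also have "\<dots> \<le> norm \<rho> ^ m * (K1 ^ m * (K2 ^ m / fact m)) * K3 ^ m"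
        using K1(1) K2(1) K3(1) unfolding m_def by (intro mult_left_mono power_increasing) auto
      finally show "norm (D k n) \<le> (norm \<rho> * K1 * K2 * K3) ^ (k + 2 * n) / fact (k + 2 * n)"
        by (simp add: m_def power_mult_distrib mult_ac)
    qed (use K1(1) K2(1) K3(1) in auto)
  qed

  \<comment> \<open>On k + 2n = m, \<open>gegenbauer_conn_sum\<close> collects the 3F2 for (a, c)
    into the one for (a, b), which \<open>hahn_cauchy_product\<close> identifies with the Cauchy
    coefficient.\<close>
  have diag: "(\<Sum>n\<le>m div 2. D (m - 2 * n) n) = (\<Sum>j\<le>m. A j * B (m - j))" for m
  proof -
    \<comment> \<open>A range of i independent of k = m - 2n lets the sums over n and i be
      swapped.\<close>
    have t_ext: "\<Phi> k = (\<Sum>i\<le>m. t k i)" if "k \<le> m" for k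
      unfolding \<Phi>_def using that by (intro sum.mono_neutral_left) (auto simp: t_def pochhammer_of_nat_eq_0_iff)
    define w where "w = (\<lambda>i. pochhammer \<alpha> i / (pochhammer (of_real (2 * p)) i * fact i))"
    define g where "g = (\<lambda>i k. pochhammer (- real k) i * pochhammer (real k + 2 * \<mu>) i / pochhammer (\<mu> + 1/2) i)"
    have t_eq: "t k i = of_real (g i k) * w i" for k i
    proof -
      have "pochhammer (- of_nat k) i = complex_of_real (pochhammer (- real k) i)"
        "pochhammer (of_real (2 * \<mu>) + of_nat k) i = complex_of_real (pochhammer (real k + 2 * \<mu>) i)"
        "pochhammer (of_real (p + r)) i = complex_of_real (pochhammer (\<mu> + 1/2) i)"
        unfolding pochhammer_of_real[symmetric] by (simp_all add: \<mu>_def add_ac)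
      thus ?thesis by (simp add: t_def g_def w_def)
    qed
    have "(\<Sum>n\<le>m div 2. D (m - 2 * n) n) = (\<Sum>n\<le>m div 2. \<Sum>i\<le>m. (\<i> * \<rho>) ^ m * of_real (R m) * w i * of_real (gegenbauer_conn \<nu> \<mu> (m - 2 * n) n * g i (m - 2 * n)))"
      by (intro sum.cong refl) (auto simp: D_def t_ext t_eq sum_distrib_left mult_ac)
    also have "\<dots> = (\<Sum>i\<le>m. (\<i> * \<rho>) ^ m * of_real (R m) * w i * of_real (\<Sum>n\<le>m div 2. gegenbauer_conn \<nu> \<mu> (m - 2 * n) n * g i (m - 2 * n)))"
      by (subst sum.swap) (simp add: sum_distrib_left)
    also have "\<dots> = (\<i> * \<rho>) ^ m * of_real (R m) / fact m * (\<Sum>i\<le>m. pochhammer (- of_nat m) i * pochhammer (of_nat m + of_real (2 * p) + of_real (2 * q) - 1) i * pochhammer \<alpha> i /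
              (pochhammer (of_real (2 * p)) i * pochhammer (\<alpha> + \<beta>) i * fact i))"
      unfolding sum_distrib_left
    proof (intro sum.cong refl)
      fix i
      have e: "pochhammer (- of_nat m) i = complex_of_real (pochhammer (- real m) i)"
        "pochhammer (of_nat m + of_real (2 * p) + of_real (2 * q) - 1) i = complex_of_real (pochhammer (real m + 2 * \<nu>) i)"
        "pochhammer (\<alpha> + \<beta>) i = complex_of_real (pochhammer (\<nu> + 1/2) i)"
        unfolding pochhammer_of_real[symmetric] \<alpha>\<beta> by (simp_all add: \<nu>_def algebra_simps)
      show "(\<i> * \<rho>) ^ m * of_real (R m) * w i * of_real (\<Sum>n\<le>m div 2. gegenbauer_conn \<nu> \<mu> (m - 2 * n) n * g i (m - 2 * n)) =
         (\<i> * \<rho>) ^ m * of_real (R m) / fact m * (pochhammer (- of_nat m) i * pochhammer (of_nat m + of_real (2 * p) + of_real (2 * q) - 1) i * pochhammer \<alpha> i /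
              (pochhammer (of_real (2 * p)) i * pochhammer (\<alpha> + \<beta>) i * fact i))"
        unfolding e g_def gegenbauer_conn_sum[OF \<nu>] by (simp add: w_def mult_ac)
    qed
    also have "\<dots> = (\<i> * \<rho>) ^ m * (pochhammer (\<alpha> + \<beta>) m / (pochhammer (of_real (2 * q)) m * fact m) * (\<Sum>i\<le>m. pochhammer (- of_nat m) i * pochhammer (of_nat m + of_real (2 * p) + of_real (2 * q) - 1) i * pochhammer \<alpha> i /
              (pochhammer (of_real (2 * p)) i * pochhammer (\<alpha> + \<beta>) i * fact i)))"
      unfolding \<alpha>\<beta> R_def pochhammer_of_real by simp
    also have "\<dots> = (\<i> * \<rho>) ^ m * (\<Sum>j\<le>m. (-1) ^ j * pochhammer \<alpha> j * pochhammer \<beta> (m - j) /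
              (pochhammer (of_real (2 * p)) j * pochhammer (of_real (2 * q)) (m - j) * fact j * fact (m - j)))"
    proof (subst hahn_cauchy_product)
      have "pochhammer (complex_of_real s) n \<noteq> 0" if "s > 0" for s n
        using pochhammer_pos[OF that, of n] by (simp add: pochhammer_of_real)
      thus "pochhammer (complex_of_real (2 * p)) n \<noteq> 0" "pochhammer (complex_of_real (2 * q)) n \<noteq> 0"
        "pochhammer (\<alpha> + \<beta>) n \<noteq> 0" for n
        unfolding \<alpha>\<beta> using pqr by (simp_all del: of_real_add of_real_mult)
    qed simp
    also have "\<dots> = (\<Sum>j\<le>m. A j * B (m - j))"
      unfolding sum_distrib_left
    proof (intro sum.cong refl)
      fix j assume "j \<in> {..m}"
      hence "(\<i> * \<rho>) ^ m = (\<i> * \<rho>) ^ j * (\<i> * \<rho>) ^ (m - j)" by (simp flip: power_add)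
      moreover have "(- \<i> * \<rho>) ^ j = (-1) ^ j * (\<i> * \<rho>) ^ j" by (simp flip: power_mult_distrib)
      ultimately show "(\<i> * \<rho>) ^ m * ((-1) ^ j * pochhammer \<alpha> j * pochhammer \<beta> (m - j) /
              (pochhammer (of_real (2 * p)) j * pochhammer (of_real (2 * q)) (m - j) * fact j * fact (m - j))) = A j * B (m - j)"
        by (simp only: A_def B_def) (simp add: mult_ac)
    qed
    finally show ?thesis .
  qed
  have "(\<lambda>m. \<Sum>n\<le>m div 2. D (m - 2 * n) n) sums ((\<Sum>n. A n) * (\<Sum>n. B n))"
    unfolding diag A_def B_def by (intro Cauchy_product_sums hypergeometric_1F1_sums) (use pqr in auto)
  note main = sums_rearrange_diagonal[OF summ this]
  have AB: "hypergeometric [\<alpha>] [of_real (2 * p)] (- \<i> * \<rho>) = (\<Sum>n. A n)"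
    "hypergeometric [\<beta>] [of_real (2 * q)] (\<i> * \<rho>) = (\<Sum>n. B n)"
    unfolding A_def B_def using pqr by (intro hypergeometric_1F1_sums; simp)+
  have kth_term: "of_real (pochhammer (real k + 2 * p + 2 * q - 1) k /
      (pochhammer (2 * p) k * pochhammer (2 * q) k * pochhammer (real k + 2 * p + 2 * r - 1) k)) * \<rho> ^ k * continuous_hahn k x a c
      * (\<Sum>n. of_real (coeff_4F5 p q r k n) * (- (\<rho>\<^sup>2) / 4) ^ n) = (\<Sum>n. D k n)" for k
  proof -
    define P where "P = pochhammer (real k + 2 * p + 2 * q - 1) k /
      (pochhammer (2 * p) k * pochhammer (2 * q) k * pochhammer (real k + 2 * p + 2 * r - 1) k)"
    define H where "H = pochhammer (2 * p) k * pochhammer (p + r) k / fact k"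
    have mu: "2 * p + 2 * r - 1 = 2 * \<mu>" by (simp add: \<mu>_def)
    have hahn: "continuous_hahn k x a c = \<i> ^ k * of_real H * \<Phi> k"
      using continuous_hahn_altdef[of a c k x] assms unfolding \<Phi>_def t_def H_def \<alpha>_def mu[symmetric] p_def r_def by simp
    define C where "C = of_real P * \<rho> ^ k * continuous_hahn k x a c"
    have D: "D k n = C * (of_real (coeff_4F5 p q r k n) * (- (\<rho>\<^sup>2) / 4) ^ n)" for n
    proof -
      have 1: "R (k + 2 * n) * gegenbauer_conn \<nu> \<mu> k n = P * H * (coeff_4F5 p q r k n / 4 ^ n)"
        unfolding P_def H_def R_def \<nu>_def \<mu>_def by (rule coeff_4F5_conn[OF pqr, symmetric])
      have 2: "(- (\<rho>\<^sup>2) / 4) ^ n = (\<i> * \<rho>) ^ (2 * n) / 4 ^ n"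
        unfolding power_mult power_divide[symmetric] by (simp add: power_mult_distrib)
      have 3: "(\<i> * \<rho>) ^ (k + 2 * n) = \<i> ^ k * \<rho> ^ k * (\<i> * \<rho>) ^ (2 * n)"
        by (simp only: power_add power_mult_distrib)
      show ?thesis
        unfolding D_def C_def hahn 1 2 3 by (simp only: of_real_mult of_real_divide of_real_power) simp
    qed
    have "C * (\<Sum>n. of_real (coeff_4F5 p q r k n) * (- (\<rho>\<^sup>2) / 4) ^ n) = (\<Sum>n. D k n)"
    \<comment> \<open>If C = 0 both sides vanish; otherwise summability of \<open>D k\<close> passes
      to the 4F5 series on division by C.\<close>
    proof (cases "C = 0")
      case False
      thus ?thesis using main(2)[of k] unfolding D by (simp add: suminf_mult summable_cmult_iff)
    qed (simp add: D)
    thus ?thesis unfolding C_def P_def .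
  qed
  show ?thesis
    using main(1) pqr(1,2) unfolding kth_term[symmetric] AB[symmetric] \<alpha>_def \<beta>_def p_def q_def r_def
    by (simp only: hypergeometric_4F5_altdef)
qed

end
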